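(* Let $(\overline{K}(X)|K,v)$ be an extension of valued fields. Assume that $(K(X)|K,v)$ is valuation transcendental and that $vK$ is cofinal in $vK(X)$. Let $\widehat{K}$ be the completion of $(K,v)$ and fix an extension of $v$ to $\overline{\widehat{K}}$. Take a minimal pair of definition $(a,\gamma)$ for $v$ over $K$. Then $(a,\gamma)$ is also a minimal pair of definition for the induced extension $(\widehat{K}(X)|\widehat{K},v)$. Further, $$[K(a):K]=[\widehat{K}(a):\widehat{K}]\quad\text{and}\quad(\widehat{K}(X)|K(X),v)\text{ is immediate}.$$
   Context: Valuations are Krull valuations written additively; $vL$, $Lv$ denote value group and residue field. An extension $(L|K,v)$ is immediate if $vL=vK$ and $Lv=Kv$. $(K,v)$ is dense in $(L,v)$ if for every $a\in L$, $\gamma\in vL$ there is $b\in K$ with $v(a-b)>\gamma$; the completion $(\widehat{K},v)$ is the maximal extension in which $(K,v)$ is dense. $\overline{K}\subseteq\overline{\widehat{K}}$ are algebraic closures; the extension of $v$ to $\overline{\widehat{K}}$ is understood to extend both the valuation of $\widehat{K}$ and the given one on $\overline{K}$. $(K(X)|K,v)$ is value transcendental if $\dim_{\mathbb{Q}}\big((vK(X)/vK)\otimes\mathbb{Q}\big)=1$, residue transcendental if $\mathrm{trdeg}[K(X)v:Kv]=1$, and valuation transcendental if it is one of these. For $a\in\overline{F}$ and $\gamma$ in an ordered abelian group containing $v\overline{F}$, $v_{a,\gamma}$ is the valuation on $\overline{F}(X)$ with $v_{a,\gamma}\big(\sum C_i(X-a)^i\big)=\min_i\{vC_i+i\gamma\}$.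 A pair $(a,\gamma)\in\overline{F}\times v\overline{F}(X)$ is a pair of definition for a valuation $v$ on $\overline{F}(X)$ over $F$ if $v=v_{a,\gamma}$. It is a minimal pair of definition for $v$ over $F$ if moreover $[F(a):F]\le[F(b):F]$ for all $b\in\overline{F}$ with $v(a-b)\ge\gamma$. The induced extension: take a pair of definition $(a,\gamma)$ for $v$ over $K$; the valuation $v_{a,\gamma}$ on $\overline{\widehat{K}}(X)$ (formed from $v$ on $\overline{\widehat{K}}$) extends $v$ on $\overline{K}(X)$, does not depend on the choice of pair, and its restriction to $\widehat{K}(X)$, again denoted $v$, gives the induced extension $(\widehat{K}(X)|\widehat{K},v)$. Pairs of definition for the induced extension are over $\widehat{K}$ and refer to this valuation on $\overline{\widehat{K}}(X)$. *)

theory Defs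
  imports
    "HOL-Algebra.Algebraic_Closure_Type"
    "HOL-Algebra.Generated_Fields"
    "HOL-Algebra.Free_Abelian_Groups"
    "HOL-Computational_Algebra.Polynomial_Factorial"
begin

section \<open>Valued fields\<close>

text \<open>
  Krull valuations are written additively. The value \<open>v 0 = \<infinity>\<close> is not represented: \<open>v\<close> takes values
  in the ordered abelian group itself, \<open>v \<zero>\<close> is irrelevant, and a condition such as
  \<open>v x > \<gamma>\<close> is spelled out as \<open>x = \<zero> \<or> v x > \<gamma>\<close>. Likewise the values of \<open>v\<close> outside the field are
  irrelevant. An extension \<open>(L|K,v)\<close> is given by the field \<open>L\<close>, a subfield \<open>K\<close> of \<open>L\<close> and \<open>v\<close> on \<open>L\<close>.
\<close>

definition valued_field ::
    "('b, 'm) ring_scheme \<Rightarrow> ('b \<Rightarrow> 'g::linordered_ab_group_add) \<Rightarrow> bool" where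
  "valued_field L v \<longleftrightarrow> field L \<and>
     (\<forall>x \<in> carrier L - {\<zero>\<^bsub>L\<^esub>}. \<forall>y \<in> carrier L - {\<zero>\<^bsub>L\<^esub>}.
        v (x \<otimes>\<^bsub>L\<^esub> y) = v x + v y \<and>
        (x \<oplus>\<^bsub>L\<^esub> y \<noteq> \<zero>\<^bsub>L\<^esub> \<longrightarrow> min (v x) (v y) \<le> v (x \<oplus>\<^bsub>L\<^esub> y)))"

definition valued_extension ::
    "('b, 'm) ring_scheme \<Rightarrow> ('b \<Rightarrow> 'g::linordered_ab_group_add) \<Rightarrow> 'b set \<Rightarrow> ('b \<Rightarrow> 'g) \<Rightarrow> bool" where
  "valued_extension L w K v \<longleftrightarrow>
     valued_field L w \<and> subfield K L \<and> (\<forall>x \<in> K - {\<zero>\<^bsub>L\<^esub>}. w x = v x)"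

definition value_group ::
    "('b, 'm) ring_scheme \<Rightarrow> ('b \<Rightarrow> 'g::linordered_ab_group_add) \<Rightarrow> 'b set \<Rightarrow> 'g set" where
  "value_group L v K = v ` (K - {\<zero>\<^bsub>L\<^esub>})"

definition valuation_ring ::
    "('b, 'm) ring_scheme \<Rightarrow> ('b \<Rightarrow> 'g::linordered_ab_group_add) \<Rightarrow> ('b, 'm) ring_scheme" where
  "valuation_ring L v = L\<lparr>carrier := {x \<in> carrier L. x = \<zero>\<^bsub>L\<^esub> \<or> 0 \<le> v x}\<rparr>"

definition valuation_ideal ::
    "('b, 'm) ring_scheme \<Rightarrow> ('b \<Rightarrow> 'g::linordered_ab_group_add) \<Rightarrow> 'b set" where
  "valuation_ideal L v = {x \<in> carrier L. x = \<zero>\<^bsub>L\<^esub> \<or> 0 < v x}"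

definition residue_field ::
    "('b, 'm) ring_scheme \<Rightarrow> ('b \<Rightarrow> 'g::linordered_ab_group_add) \<Rightarrow> 'b set ring" where
  "residue_field L v = valuation_ring L v Quot valuation_ideal L v"

text \<open>The residue field \<open>Kv\<close>, as a subfield of \<open>Lv\<close> via the canonical embedding.\<close>

definition residues ::
    "('b, 'm) ring_scheme \<Rightarrow> ('b \<Rightarrow> 'g::linordered_ab_group_add) \<Rightarrow> 'b set \<Rightarrow> 'b set set" where
  "residues L v K =
     (\<lambda>x. valuation_ideal L v +>\<^bsub>valuation_ring L v\<^esub> x) ` (K \<inter> carrier (valuation_ring L v))"

definition immediate ::
    "('b, 'm) ring_scheme \<Rightarrow> ('b \<Rightarrow> 'g::linordered_ab_group_add) \<Rightarrow> 'b set \<Rightarrow> ('b \<Rightarrow> 'g) \<Rightarrow> bool" where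
  "immediate L w K v \<longleftrightarrow> valued_extension L w K v \<and>
     value_group L w (carrier L) = value_group L w K \<and>
     carrier (residue_field L w) = residues L w K"

definition dense_in ::
    "('b, 'm) ring_scheme \<Rightarrow> ('b \<Rightarrow> 'g::linordered_ab_group_add) \<Rightarrow> 'b set \<Rightarrow> bool" where
  "dense_in L v K \<longleftrightarrow>
     (\<forall>a \<in> carrier L. \<forall>\<gamma> \<in> value_group L v (carrier L).
        \<exists>b \<in> K. a \<ominus>\<^bsub>L\<^esub> b = \<zero>\<^bsub>L\<^esub> \<or> v (a \<ominus>\<^bsub>L\<^esub> b) > \<gamma>)"

text \<open>
  \<open>L\<close> is a maximal extension of \<open>K\<close> in which \<open>K\<close> is dense: no proper valued extension field \<open>M\<close> of
  \<open>L\<close> has \<open>K\<close> dense in it. It is enough to let \<open>M\<close> range over fields with carrier in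
  \<open>'g \<Rightarrow> 'b set\<close> and value group in \<open>'g\<close>: if \<open>K\<close> is dense in \<open>(M,u)\<close>, then \<open>uM = uK\<close>, and
  \<open>c \<mapsto> (\<lambda>\<gamma>. {x \<in> K. u (c - x) > \<gamma>})\<close> is an injection of \<open>M\<close> into \<open>'g \<Rightarrow> 'b set\<close>.
\<close>

definition is_completion ::
    "('b, 'm) ring_scheme \<Rightarrow> ('b \<Rightarrow> 'g::linordered_ab_group_add) \<Rightarrow> 'b set \<Rightarrow> bool" where
  "is_completion L w K \<longleftrightarrow>
     valued_field L w \<and> subfield K L \<and> dense_in L w K \<and>
     (\<forall>(M :: ('g \<Rightarrow> 'b set) ring) u h.
        valued_field M u \<and> h \<in> ring_hom L M \<and>
        (\<forall>x \<in> carrier L - {\<zero>\<^bsub>L\<^esub>}. u (h x) = w x) \<and> dense_in M u (h ` K)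
        \<longrightarrow> h ` carrier L = carrier M)"


section \<open>Valuation transcendental extensions\<close>

text \<open>
  \<open>A \<otimes> \<rat>\<close> for an abelian group \<open>A\<close> (over the integers): the free abelian group on
  \<open>A \<times> \<rat>\<close> modulo the bilinearity relations.
\<close>

definition tensor_rat_relations ::
    "('h, 'm) monoid_scheme \<Rightarrow> (('h \<times> rat) \<Rightarrow>\<^sub>0 int) set" where
  "tensor_rat_relations A =
     generate (free_Abelian_group (carrier A \<times> UNIV))
       ({frag_of (x \<otimes>\<^bsub>A\<^esub> y, q) - frag_of (x, q) - frag_of (y, q) | x y q.
           x \<in> carrier A \<and> y \<in> carrier A} \<union>
        {frag_of (x, q + r) - frag_of (x, q) - frag_of (x, r) | x q r. x \<in> carrier A})"

definition tensor_rat ::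
    "('h, 'm) monoid_scheme \<Rightarrow> (('h \<times> rat) \<Rightarrow>\<^sub>0 int) set monoid" where
  "tensor_rat A = free_Abelian_group (carrier A \<times> UNIV) Mod tensor_rat_relations A"

text \<open>The scalar multiplication of \<open>A \<otimes> \<rat>\<close>, induced by \<open>q \<cdot> (x \<otimes> r) = x \<otimes> q r\<close>.\<close>

definition tensor_rat_smult ::
    "('h, 'm) monoid_scheme \<Rightarrow> rat \<Rightarrow> (('h \<times> rat) \<Rightarrow>\<^sub>0 int) set \<Rightarrow> (('h \<times> rat) \<Rightarrow>\<^sub>0 int) set" where
  "tensor_rat_smult A q C =
     (\<Union>c \<in> C. tensor_rat_relations A #>\<^bsub>free_Abelian_group (carrier A \<times> UNIV)\<^esub>
                  frag_extend (\<lambda>(x, r). frag_of (x, q * r)) c)"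

text \<open>\<open>dim\<^sub>\<rat> (A \<otimes> \<rat>) = n\<close>: there is a basis with \<open>n\<close> elements.\<close>

definition rat_tensor_dim_is :: "('h, 'm) monoid_scheme \<Rightarrow> nat \<Rightarrow> bool" where
  "rat_tensor_dim_is A n \<longleftrightarrow>
     (\<exists>B \<subseteq> carrier (tensor_rat A). finite B \<and> card B = n \<and>
        (\<forall>x \<in> carrier (tensor_rat A). \<exists>!c. c \<in> B \<rightarrow>\<^sub>E UNIV \<and>
           x = finprod (tensor_rat A) (\<lambda>b. tensor_rat_smult A (c b) b) B))"

definition value_transcendental ::
    "('b, 'm) ring_scheme \<Rightarrow> ('b \<Rightarrow> 'g::linordered_ab_group_add) \<Rightarrow> 'b set \<Rightarrow> bool" where
  "value_transcendental L v K \<longleftrightarrow>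
     rat_tensor_dim_is
       (\<lparr>carrier = value_group L v (carrier L), monoid.mult = (+), one = 0\<rparr> Mod value_group L v K) 1"

text \<open>
  A set is algebraically independent over \<open>K\<close> iff each of its elements is transcendental over the
  field generated over \<open>K\<close> by the others.
\<close>

definition transcendence_basis :: "('b, 'm) ring_scheme \<Rightarrow> 'b set \<Rightarrow> 'b set \<Rightarrow> bool" where
  "transcendence_basis L K T \<longleftrightarrow> T \<subseteq> carrier L \<and>
     (\<forall>t \<in> T. ring.transcendental L (generate_field L (K \<union> (T - {t}))) t) \<and>
     (\<forall>x \<in> carrier L. ring.algebraic L (generate_field L (K \<union> T)) x)"

definition trdeg_is :: "('b, 'm) ring_scheme \<Rightarrow> 'b set \<Rightarrow> nat \<Rightarrow> bool" where
  "trdeg_is L K n \<longleftrightarrow> (\<exists>T. transcendence_basis L K T \<and> finite T \<and> card T = n)"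

definition residue_transcendental ::
    "('b, 'm) ring_scheme \<Rightarrow> ('b \<Rightarrow> 'g::linordered_ab_group_add) \<Rightarrow> 'b set \<Rightarrow> bool" where
  "residue_transcendental L v K \<longleftrightarrow> trdeg_is (residue_field L v) (residues L v K) 1"

definition valuation_transcendental ::
    "('b, 'm) ring_scheme \<Rightarrow> ('b \<Rightarrow> 'g::linordered_ab_group_add) \<Rightarrow> 'b set \<Rightarrow> bool" where
  "valuation_transcendental L v K \<longleftrightarrow> value_transcendental L v K \<or> residue_transcendental L v K"


section \<open>Algebraic elements and rational functions\<close>

text \<open>
  The ambient type \<open>'a\<close> is an algebraically closed field, and all base fields \<open>F\<close> are subfields of
  it. Then the elements of \<open>'a\<close> that are algebraic over \<open>F\<close> form an algebraic closure of \<open>F\<close>.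
\<close>

definition algebraic_closure_in :: "'a::alg_closed_field set \<Rightarrow> 'a set" where
  "algebraic_closure_in F = {x. ring.algebraic ring_of_type_algebra F x}"

definition simple_degree :: "'a::field set \<Rightarrow> 'a \<Rightarrow> nat" where
  "simple_degree F a =
     ring.dim ring_of_type_algebra F (generate_field ring_of_type_algebra (insert a F))"

definition polys_over :: "'a::field set \<Rightarrow> 'a poly set" where
  "polys_over F = {p. \<forall>i. poly.coeff p i \<in> F}"

definition const_fract :: "'a::field \<Rightarrow> 'a poly fract" where
  "const_fract c = to_fract [:c:]"

definition ratfuns :: "'a::field set \<Rightarrow> 'a poly fract set" where
  "ratfuns F = {to_fract p / to_fract q | p q. p \<in> polys_over F \<and> q \<in> polys_over F \<and> q \<noteq> 0}"

definition ratfun_field :: "'a::field set \<Rightarrow> 'a poly fract ring" where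
  "ratfun_field F = ring_of_type_algebra\<lparr>carrier := ratfuns F\<rparr>"


section \<open>Pairs of definition\<close>

text \<open>
  For \<open>p = (\<Sum>i. C i * (X - a) ^ i)\<close> the coefficient \<open>C i\<close> is the \<open>i\<close>-th coefficient of \<open>p(X + a)\<close>.
  The multiple \<open>i\<gamma>\<close> is written as \<open>\<Sum>_<i. \<gamma>\<close>.
\<close>

definition pair_val_poly ::
    "('a::field \<Rightarrow> 'g::linordered_ab_group_add) \<Rightarrow> 'a \<Rightarrow> 'g \<Rightarrow> 'a poly \<Rightarrow> 'g" where
  "pair_val_poly v a \<gamma> p =
     (let C = poly.coeff (pcompose p [:a, 1:])
      in Min ((\<lambda>i. v (C i) + (\<Sum>_<i. \<gamma>)) ` {i. C i \<noteq> 0}))"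

text \<open>
  The valuation \<open>v\<^bsub>a,\<gamma>\<^esub>\<close> on \<open>F(X)\<close>, for \<open>v\<close> a valuation on \<open>F\<close> and \<open>a\<close> in \<open>F\<close>; the value does not
  depend on the chosen representation as a quotient.
\<close>

definition pair_val ::
    "'a::field set \<Rightarrow> ('a \<Rightarrow> 'g::linordered_ab_group_add) \<Rightarrow> 'a \<Rightarrow> 'g \<Rightarrow> 'a poly fract \<Rightarrow> 'g" where
  "pair_val F v a \<gamma> r =
     (SOME \<delta>. \<exists>p \<in> polys_over F. \<exists>q \<in> polys_over F. p \<noteq> 0 \<and> q \<noteq> 0 \<and>
        r = to_fract p / to_fract q \<and> \<delta> = pair_val_poly v a \<gamma> p - pair_val_poly v a \<gamma> q)"

definition pair_of_definition ::
    "'a::alg_closed_field set \<Rightarrow> ('a poly fract \<Rightarrow> 'g::linordered_ab_group_add) \<Rightarrow> 'a \<Rightarrow> 'g \<Rightarrow> bool" where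
  "pair_of_definition F v a \<gamma> \<longleftrightarrow>
     a \<in> algebraic_closure_in F \<and> \<gamma> \<in> v ` (ratfuns (algebraic_closure_in F) - {0}) \<and>
     (\<forall>r \<in> ratfuns (algebraic_closure_in F) - {0}.
        v r = pair_val (algebraic_closure_in F) (v \<circ> const_fract) a \<gamma> r)"

definition minimal_pair_of_definition ::
    "'a::alg_closed_field set \<Rightarrow> ('a poly fract \<Rightarrow> 'g::linordered_ab_group_add) \<Rightarrow> 'a \<Rightarrow> 'g \<Rightarrow> bool" where
  "minimal_pair_of_definition F v a \<gamma> \<longleftrightarrow> pair_of_definition F v a \<gamma> \<and>
     (\<forall>b \<in> algebraic_closure_in F.
        a = b \<or> \<gamma> \<le> v (const_fract (a - b)) \<longrightarrow> simple_degree F a \<le> simple_degree F b)"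

text \<open>
  For \<open>v\<close> on the rational function field of the algebraic closure of \<open>K\<close> and \<open>w\<close> on the ambient
  algebraically closed field, \<open>u\<close> is the valuation inducing the extension of \<open>v\<close> to \<open>L(X)\<close>, where
  \<open>L\<close> is the completion of \<open>K\<close>.
\<close>

definition is_induced_valuation ::
    "'a::alg_closed_field set \<Rightarrow> ('a poly fract \<Rightarrow> 'g::linordered_ab_group_add) \<Rightarrow> ('a \<Rightarrow> 'g) \<Rightarrow>
     ('a poly fract \<Rightarrow> 'g) \<Rightarrow> bool" where
  "is_induced_valuation K v w u \<longleftrightarrow>
     (\<exists>a \<gamma>. pair_of_definition K v a \<gamma> \<and> u = pair_val UNIV w a \<gamma>)"

end

theory Submission
  imports Defs
begin

text \<open>
  By the Gauss lemma, \<open>v\<^bsub>a,\<gamma>\<^esub>\<close> is a valuation on the rational function field over the ambient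
  field, and it is unchanged when \<open>a\<close> is replaced by some \<open>b\<close> with \<open>w (a - b) \<ge> \<gamma>\<close>; hence the induced
  valuation is \<open>v\<^bsub>a,\<gamma>\<^esub>\<close> for the given pair. Cofinality bounds \<open>\<gamma>\<close>, all values of algebraic elements and all values of rational
  functions by values of \<open>K\<close>, so coefficients in the completion can be replaced by elements of \<open>K\<close>
  up to any error that matters. For numerators and denominators of rational functions this gives
  immediacy. For the minimal polynomial over the completion of some \<open>b\<close> with \<open>w (a - b) \<ge> \<gamma>\<close> it gives
  a polynomial over \<open>K\<close> of the same degree with a root \<open>c\<close> such that \<open>w (a - c) \<ge> \<gamma>\<close>; by minimality
  over \<open>K\<close> its degree is at least \<open>[K(a) : K]\<close>.
\<close>

section \<open>Gauss valuations\<close>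

text \<open>Kept as an abbreviation so that the multiples occurring in \<open>pair_val_poly\<close>
  are literally the same terms.\<close>

abbreviation nat_mult :: "nat \<Rightarrow> 'g::linordered_ab_group_add \<Rightarrow> 'g" (infixr \<open>\<cdot>\<close> 75) where
  "n \<cdot> \<gamma> \<equiv> (\<Sum>_<n. \<gamma>)"

lemma nat_mult_add: "(m + n) \<cdot> \<gamma> = m \<cdot> \<gamma> + n \<cdot> \<gamma>"
  by (induction m) (simp_all add: add_ac)

section \<open>Krull valuations and the strict triangle inequality\<close>

locale krull_valuation =
  fixes w :: "'a::field \<Rightarrow> 'g::linordered_ab_group_add"
  assumes mult: "x \<noteq> 0 \<Longrightarrow> y \<noteq> 0 \<Longrightarrow> w (x * y) = w x + w y"
    and add: "x \<noteq> 0 \<Longrightarrow> y \<noteq> 0 \<Longrightarrow> x + y \<noteq> 0 \<Longrightarrow> min (w x) (w y) \<le> w (x + y)"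
begin

text \<open>The value at \<open>0\<close> should be infinite, but \<open>w 0\<close> is arbitrary.
  Predicates that hold at \<open>0\<close> by fiat allow estimates of sums and products without
  separating zero terms.\<close>

definition ge :: "'g \<Rightarrow> 'a \<Rightarrow> bool" where "ge \<delta> x \<longleftrightarrow> x = 0 \<or> \<delta> \<le> w x"
definition gt :: "'g \<Rightarrow> 'a \<Rightarrow> bool" where "gt \<delta> x \<longleftrightarrow> x = 0 \<or> \<delta> < w x"

lemma one [simp]: "w 1 = 0"
  using mult[of 1 1] by simp

lemma inverse: "x \<noteq> 0 \<Longrightarrow> w (inverse x) = - w x"
  using mult[of x "inverse x"] by (simp add: add_eq_0_iff)

lemma divide: "x \<noteq> 0 \<Longrightarrow> y \<noteq> 0 \<Longrightarrow> w (x / y) = w x - w y"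
  by (simp add: divide_inverse mult inverse)

text \<open>An ordered group has no 2-torsion.\<close>

lemma minus_one: "w (- 1) = 0"
  using mult[of "-1" "-1"] by (simp add: double_zero_sym)

lemma minus [simp]: "w (- x) = w x"
  using mult[of "-1" x] minus_one by (cases "x = 0") simp_all

lemma power: "x \<noteq> 0 \<Longrightarrow> w (x ^ n) = n \<cdot> w x"
  by (induction n) (simp_all add: mult add_ac)

lemma ge_0 [simp]: "ge \<delta> 0" and gt_0 [simp]: "gt \<delta> 0"
  by (simp_all add: ge_def gt_def)

lemma ge_minus [simp]: "ge \<delta> (- x) \<longleftrightarrow> ge \<delta> x" and gt_minus [simp]: "gt \<delta> (- x) \<longleftrightarrow> gt \<delta> x"
  by (simp_all add: ge_def gt_def)

lemma ge_add: "ge \<delta> x \<Longrightarrow> ge \<delta> y \<Longrightarrow> ge \<delta> (x + y)"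
  unfolding ge_def using add[of x y] by (metis add.left_neutral add.right_neutral min.boundedI order_trans)

lemma gt_add: "gt \<delta> x \<Longrightarrow> gt \<delta> y \<Longrightarrow> gt \<delta> (x + y)"
  unfolding gt_def using add[of x y] by (metis add.left_neutral add.right_neutral min_less_iff_conj less_le_trans)

lemma gt_diff: "gt \<delta> x \<Longrightarrow> gt \<delta> y \<Longrightarrow> gt \<delta> (x - y)"
  using gt_add[of \<delta> x "- y"] by simp

lemma ge_sum: "(\<And>i. i \<in> A \<Longrightarrow> ge \<delta> (f i)) \<Longrightarrow> ge \<delta> (sum f A)"
  by (induction A rule: infinite_finite_induct) (auto intro: ge_add)

lemma gt_sum: "(\<And>i. i \<in> A \<Longrightarrow> gt \<delta> (f i)) \<Longrightarrow> gt \<delta> (sum f A)"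
  by (induction A rule: infinite_finite_induct) (auto intro: gt_add)

lemma ge_mult: "ge \<delta> x \<Longrightarrow> ge \<epsilon> y \<Longrightarrow> ge (\<delta> + \<epsilon>) (x * y)"
  by (cases "x = 0 \<or> y = 0") (auto simp: ge_def mult add_mono)

lemma gt_mult_nonzero: "gt \<delta> x \<Longrightarrow> y \<noteq> 0 \<Longrightarrow> gt (\<delta> + w y) (x * y)"
  by (cases "x = 0") (auto simp: gt_def mult)

lemma gt_mono: "gt \<delta> x \<Longrightarrow> \<epsilon> \<le> \<delta> \<Longrightarrow> gt \<epsilon> x"
  unfolding gt_def by auto

text \<open>The summand of strictly smaller value decides: otherwise \<open>x = (x + y) - y\<close>
  would have a value greater than its own.\<close>

lemma eq_add_gt:
  assumes "x \<noteq> 0" "gt (w x) y"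
  shows "x + y \<noteq> 0" "w (x + y) = w x"
proof -
  show nz: "x + y \<noteq> 0"
  proof
    assume "x + y = 0"
    then have "y = - x" by (simp add: add_eq_0_iff)
    then show False using assms by (auto simp: gt_def)
  qed
  have "ge (w x) (x + y)"
    using assms by (intro ge_add) (auto simp: ge_def gt_def)
  moreover have "\<not> gt (w x) (x + y)"
    using gt_diff[of "w x" "x + y" y] assms by (auto simp: gt_def)
  ultimately show "w (x + y) = w x"
    using nz by (auto simp: ge_def gt_def)
qed

lemma eq_of_gt_diff:
  assumes "x \<noteq> 0" "gt (w x) (x - y)"
  shows "y \<noteq> 0" "w y = w x"
  using eq_add_gt[OF assms(1), of "- (x - y)"] assms(2) unfolding gt_minus by simp_all

end

section \<open>The Gauss valuation of polynomials\<close>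

lemma finite_coeff_support: "finite {i. poly.coeff p i \<noteq> 0}"
  by (rule finite_subset[of _ "{..Polynomial.degree p}"]) (auto intro: le_degree)

text \<open>The valuation of the pair with centre \<open>0\<close>, in which \<open>X\<close> has
  value \<gamma>. At \<open>p = 0\<close> it is \<open>Min\<close> of the empty set and carries no
  information.\<close>

definition gauss_val ::
    "('a::field \<Rightarrow> 'g::linordered_ab_group_add) \<Rightarrow> 'g \<Rightarrow> 'a poly \<Rightarrow> 'g" where
  "gauss_val w \<gamma> p = Min ((\<lambda>i. w (poly.coeff p i) + i \<cdot> \<gamma>) ` {i. poly.coeff p i \<noteq> 0})"

lemma pair_val_poly_eq_gauss_val: "pair_val_poly w a \<gamma> p = gauss_val w \<gamma> (pcompose p [:a, 1:])"
  by (simp add: pair_val_poly_def gauss_val_def Let_def)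

lemma gauss_val_le: "poly.coeff p i \<noteq> 0 \<Longrightarrow> gauss_val w \<gamma> p \<le> w (poly.coeff p i) + i \<cdot> \<gamma>"
  unfolding gauss_val_def by (rule Min_le) (use finite_coeff_support in auto)

lemma gauss_val_attained:
  assumes "p \<noteq> 0"
  obtains i where "poly.coeff p i \<noteq> 0" "gauss_val w \<gamma> p = w (poly.coeff p i) + i \<cdot> \<gamma>"
proof -
  have "poly.coeff p (Polynomial.degree p) \<noteq> 0"
    using assms by simp
  then have "gauss_val w \<gamma> p \<in> (\<lambda>i. w (poly.coeff p i) + i \<cdot> \<gamma>) ` {i. poly.coeff p i \<noteq> 0}"
    unfolding gauss_val_def by (intro Min_in) (use finite_coeff_support in blast)+
  then show ?thesis using that by auto
qed

lemma gauss_val_cong: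
  "(\<And>i. poly.coeff p i \<noteq> 0 \<Longrightarrow> v (poly.coeff p i) = w (poly.coeff p i)) \<Longrightarrow>
     gauss_val v \<gamma> p = gauss_val w \<gamma> p"
  unfolding gauss_val_def by (metis (mono_tags, lifting) image_cong mem_Collect_eq)

context krull_valuation
begin

text \<open>A coefficientwise lower bound that also makes sense for the zero polynomial and is
  visibly stable under sums.\<close>

definition gauss_ge :: "'g \<Rightarrow> 'g \<Rightarrow> 'a poly \<Rightarrow> bool" where
  "gauss_ge \<gamma> \<delta> p \<longleftrightarrow> (\<forall>i. ge (\<delta> - i \<cdot> \<gamma>) (poly.coeff p i))"

lemma gauss_ge_gauss_val: "gauss_ge \<gamma> (gauss_val w \<gamma> p) p"
  unfolding gauss_ge_def ge_def diff_le_eq using gauss_val_le by blast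

lemma gauss_ge_iff:
  assumes "p \<noteq> 0"
  shows "gauss_ge \<gamma> \<delta> p \<longleftrightarrow> \<delta> \<le> gauss_val w \<gamma> p"
proof
  assume "gauss_ge \<gamma> \<delta> p"
  moreover obtain i where "poly.coeff p i \<noteq> 0" "gauss_val w \<gamma> p = w (poly.coeff p i) + i \<cdot> \<gamma>"
    using gauss_val_attained[OF assms] .
  ultimately show "\<delta> \<le> gauss_val w \<gamma> p"
    unfolding gauss_ge_def ge_def diff_le_eq by metis
next
  assume "\<delta> \<le> gauss_val w \<gamma> p"
  then show "gauss_ge \<gamma> \<delta> p"
    using gauss_ge_gauss_val[of \<gamma> p] unfolding gauss_ge_def ge_def diff_le_eq
    by (blast intro: order_trans)
qed

lemma gauss_ge_0 [simp]: "gauss_ge \<gamma> \<delta> 0"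
  by (simp add: gauss_ge_def)

lemma gauss_ge_add: "gauss_ge \<gamma> \<delta> p \<Longrightarrow> gauss_ge \<gamma> \<delta> q \<Longrightarrow> gauss_ge \<gamma> \<delta> (p + q)"
  by (simp add: gauss_ge_def ge_add)

lemma gauss_ge_mult:
  assumes "gauss_ge \<gamma> \<delta> p" "gauss_ge \<gamma> \<epsilon> q"
  shows "gauss_ge \<gamma> (\<delta> + \<epsilon>) (p * q)"
  unfolding gauss_ge_def coeff_mult
proof (intro allI ge_sum)
  fix n i :: nat assume "i \<in> {..n}"
  then have "n \<cdot> \<gamma> = i \<cdot> \<gamma> + (n - i) \<cdot> \<gamma>"
    by (simp flip: nat_mult_add)
  then have "\<delta> + \<epsilon> - n \<cdot> \<gamma> = (\<delta> - i \<cdot> \<gamma>) + (\<epsilon> - (n - i) \<cdot> \<gamma>)"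
    by (simp add: algebra_simps)
  then show "ge (\<delta> + \<epsilon> - n \<cdot> \<gamma>) (poly.coeff p i * poly.coeff q (n - i))"
    using assms ge_mult unfolding gauss_ge_def by metis
qed

lemma gauss_val_add:
  "p \<noteq> 0 \<Longrightarrow> q \<noteq> 0 \<Longrightarrow> p + q \<noteq> 0 \<Longrightarrow>
     min (gauss_val w \<gamma> p) (gauss_val w \<gamma> q) \<le> gauss_val w \<gamma> (p + q)"
  by (subst gauss_ge_iff[symmetric], simp, rule gauss_ge_add) (simp_all add: gauss_ge_iff)

text \<open>Gauss lemma: let \<open>m\<close> and \<open>n\<close> be the least indices attaining
  the minima for \<open>p\<close> and \<open>q\<close>. Among the terms of coefficient
  \<open>m + n\<close> of the product, the one with \<open>i = m\<close> alone has the least value,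
  so it cannot be cancelled.\<close>

lemma gauss_val_mult:
  assumes "p \<noteq> 0" "q \<noteq> 0"
  shows "gauss_val w \<gamma> (p * q) = gauss_val w \<gamma> p + gauss_val w \<gamma> q"
proof (rule antisym)
  show "gauss_val w \<gamma> p + gauss_val w \<gamma> q \<le> gauss_val w \<gamma> (p * q)"
    using assms gauss_ge_mult[OF gauss_ge_gauss_val gauss_ge_gauss_val, of \<gamma> p q]
    by (simp add: gauss_ge_iff)
next
  define A where "A r i \<longleftrightarrow> poly.coeff r i \<noteq> 0 \<and> gauss_val w \<gamma> r = w (poly.coeff r i) + i \<cdot> \<gamma>" for r i
  define m where "m = (LEAST i. A p i)"
  define n where "n = (LEAST i. A q i)"
  have m: "A p m" "A q n"
    unfolding m_def n_def
    by (rule gauss_val_attained[OF assms(1), of w \<gamma>], rule LeastI, simp add: A_def,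
        rule gauss_val_attained[OF assms(2), of w \<gamma>], rule LeastI, simp add: A_def)
  have less: "\<not> A p i" if "i < m" for i using that not_less_Least unfolding m_def by blast
  have less': "\<not> A q i" if "i < n" for i using that not_less_Least unfolding n_def by blast
  have gt: "gt (gauss_val w \<gamma> r - i \<cdot> \<gamma>) (poly.coeff r i)" if "\<not> A r i" for r i
    using that gauss_val_le[of r i w \<gamma>] unfolding A_def gt_def diff_less_eq by (metis order_le_less)
  let ?t = "\<lambda>i. poly.coeff p i * poly.coeff q (m + n - i)"
  let ?d = "gauss_val w \<gamma> p + gauss_val w \<gamma> q - (m + n) \<cdot> \<gamma>"
  have tm: "?t m \<noteq> 0" "w (?t m) = ?d"
    using m by (simp_all add: A_def mult nat_mult_add algebra_simps)
  have "gt ?d (?t i)" if i: "i \<in> {..m + n} - {m}" for i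
  proof (cases "?t i = 0")
    case False
    then have nz: "poly.coeff p i \<noteq> 0" "poly.coeff q (m + n - i) \<noteq> 0" by auto
    have eq: "(m + n) \<cdot> \<gamma> = i \<cdot> \<gamma> + (m + n - i) \<cdot> \<gamma>"
      using i by (simp flip: nat_mult_add)
    have le: "gauss_val w \<gamma> p \<le> w (poly.coeff p i) + i \<cdot> \<gamma>"
      "gauss_val w \<gamma> q \<le> w (poly.coeff q (m + n - i)) + (m + n - i) \<cdot> \<gamma>"
      using nz gauss_val_le by blast+
    \<comment> \<open>One of the two indices lies below the least one attaining its minimum, which
      makes one of the inequalities \<open>le\<close> strict.\<close>
    have "i < m \<or> m + n - i < n" using i by auto
    then have "gauss_val w \<gamma> p < w (poly.coeff p i) + i \<cdot> \<gamma> \<or>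
      gauss_val w \<gamma> q < w (poly.coeff q (m + n - i)) + (m + n - i) \<cdot> \<gamma>"
      using less less' nz le unfolding A_def by (metis order_le_less)
    then have "gauss_val w \<gamma> p + gauss_val w \<gamma> q <
      (w (poly.coeff p i) + i \<cdot> \<gamma>) + (w (poly.coeff q (m + n - i)) + (m + n - i) \<cdot> \<gamma>)"
      using le add_less_le_mono add_le_less_mono by blast
    then have "?d < w (poly.coeff p i) + w (poly.coeff q (m + n - i))"
      unfolding eq by (simp add: algebra_simps)
    then show ?thesis using nz by (simp add: gt_def mult)
  next
    case True
    then show ?thesis unfolding True by simp
  qed
  then have "gt ?d (\<Sum>i\<in>{..m + n} - {m}. ?t i)" by (rule gt_sum)
  then have "poly.coeff (p * q) (m + n) \<noteq> 0 \<and> w (poly.coeff (p * q) (m + n)) = ?d"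
    using eq_add_gt[of "?t m" "\<Sum>i\<in>{..m + n} - {m}. ?t i"] tm
    by (simp add: coeff_mult sum.remove[of "{..m + n}" m])
  then show "gauss_val w \<gamma> (p * q) \<le> gauss_val w \<gamma> p + gauss_val w \<gamma> q"
    using gauss_val_le[of "p * q" "m + n" w \<gamma>] by (simp add: algebra_simps)
qed

lemma gauss_val_linear:
  "gauss_val w \<gamma> [:d, 1:] = (if d = 0 then \<gamma> else min (w d) \<gamma>)"
proof -
  have "poly.coeff [:d, 1:] i \<noteq> 0 \<longleftrightarrow> i = 1 \<or> i = 0 \<and> d \<noteq> 0" for i
    by (cases i; cases "i - 1") simp_all
  then have "{i. poly.coeff [:d, 1:] i \<noteq> 0} = (if d = 0 then {1} else {0, 1})"
    by auto
  then show ?thesis by (simp add: gauss_val_def)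
qed

text \<open>Induction along the Horner form: the substitution turns the factor \<open>X\<close> into
  \<open>X + d\<close>, whose Gauss value is still at least \<gamma>. Removing one factor
  \<open>X\<close> lowers the bound by \<gamma>, hence the arbitrary \<delta>.\<close>

lemma gauss_ge_translate:
  assumes "ge \<gamma> d"
  shows "gauss_ge \<gamma> \<delta> p \<Longrightarrow> gauss_ge \<gamma> \<delta> (pcompose p [:d, 1:])"
proof (induction p arbitrary: \<delta>)
  case (pCons c p)
  have "gauss_ge \<gamma> (\<delta> - \<gamma>) p"
    unfolding gauss_ge_def
  proof
    fix i
    have "ge (\<delta> - Suc i \<cdot> \<gamma>) (poly.coeff (pCons c p) (Suc i))"
      using pCons.prems gauss_ge_def by blast
    then show "ge (\<delta> - \<gamma> - i \<cdot> \<gamma>) (poly.coeff p i)"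
      by (simp add: algebra_simps)
  qed
  moreover have "gauss_ge \<gamma> \<gamma> [:d, 1:]"
    using assms by (auto simp: gauss_ge_iff gauss_val_linear ge_def)
  ultimately have "gauss_ge \<gamma> (\<gamma> + (\<delta> - \<gamma>)) ([:d, 1:] * pcompose p [:d, 1:])"
    by (intro gauss_ge_mult pCons.IH)
  moreover have "ge \<delta> c"
    using pCons.prems by (auto simp: gauss_ge_def dest: spec[of _ 0])
  then have "gauss_ge \<gamma> \<delta> [:c:]"
    by (auto simp: gauss_ge_def coeff_pCons split: nat.splits)
  ultimately show ?case
    unfolding pcompose_pCons by (intro gauss_ge_add) simp_all
qed simp

text \<open>The one-sided estimate is applied to the shift by \<open>d\<close> and to the inverse
  shift by \<open>-d\<close>.\<close>

lemma gauss_val_translate: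
  assumes "ge \<gamma> d" "p \<noteq> 0"
  shows "gauss_val w \<gamma> (pcompose p [:d, 1:]) = gauss_val w \<gamma> p"
proof -
  have *: "gauss_val w \<gamma> q \<le> gauss_val w \<gamma> (pcompose q [:e, 1:])" if "ge \<gamma> e" "q \<noteq> 0" for q e
    using that(2) gauss_ge_translate[OF that(1) gauss_ge_gauss_val[of _ q]]
    by (simp add: gauss_ge_iff pcompose_eq_0_iff)
  have "pcompose (pcompose p [:d, 1:]) [:-d, 1:] = p"
    by (simp add: pcompose_assoc[symmetric] pcompose_pCons)
  with *[of d p] *[of "-d" "pcompose p [:d, 1:]"] assms show ?thesis
    by (simp add: pcompose_eq_0_iff)
qed

section \<open>Values of polynomials for an arbitrary centre\<close>

lemma pair_val_poly_mult:
  "p \<noteq> 0 \<Longrightarrow> q \<noteq> 0 \<Longrightarrow> pair_val_poly w a \<gamma> (p * q) = pair_val_poly w a \<gamma> p + pair_val_poly w a \<gamma> q"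
  by (simp add: pair_val_poly_eq_gauss_val pcompose_mult gauss_val_mult pcompose_eq_0_iff)

lemma pair_val_poly_add:
  "p \<noteq> 0 \<Longrightarrow> q \<noteq> 0 \<Longrightarrow> p + q \<noteq> 0 \<Longrightarrow>
     min (pair_val_poly w a \<gamma> p) (pair_val_poly w a \<gamma> q) \<le> pair_val_poly w a \<gamma> (p + q)"
  using gauss_val_add[of "pcompose p [:a, 1:]" "pcompose q [:a, 1:]" \<gamma>]
  by (simp add: pair_val_poly_eq_gauss_val pcompose_eq_0_iff flip: pcompose_add)

lemma pair_val_poly_translate:
  assumes "ge \<gamma> (b - a)" "p \<noteq> 0"
  shows "pair_val_poly w b \<gamma> p = pair_val_poly w a \<gamma> p"
proof -
  have "pcompose p [:b, 1:] = pcompose (pcompose p [:a, 1:]) [:b - a, 1:]"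
    by (simp add: pcompose_assoc[symmetric] pcompose_pCons)
  then show ?thesis
    using assms by (simp add: pair_val_poly_eq_gauss_val gauss_val_translate pcompose_eq_0_iff)
qed

text \<open>Linear polynomials reveal \<gamma> and the distances to the centre; two pairs defining
  the same valuation are compared through them.\<close>

lemma pair_val_poly_linear:
  "pair_val_poly w a \<gamma> [:-b, 1:] = (if a = b then \<gamma> else min (w (a - b)) \<gamma>)"
  by (simp add: pair_val_poly_eq_gauss_val pcompose_pCons gauss_val_linear)

lemma pair_val_poly_const: "c \<noteq> 0 \<Longrightarrow> pair_val_poly w a \<gamma> [:c:] = w c"
proof -
  assume "c \<noteq> 0"
  have "poly.coeff [:c:] i \<noteq> 0 \<longleftrightarrow> i = 0" for i
    using \<open>c \<noteq> 0\<close> by (cases i) simp_all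
  then have "{i. poly.coeff [:c:] i \<noteq> 0} = {0}"
    by auto
  then show ?thesis unfolding pair_val_poly_eq_gauss_val gauss_val_def pcompose_const by simp
qed

end

section \<open>Subfields and rational functions\<close>

lemma ring_of_type_algebra_simps [simp]:
  "carrier ring_of_type_algebra = UNIV"
  "x \<otimes>\<^bsub>ring_of_type_algebra\<^esub> y = x * y"
  "\<one>\<^bsub>ring_of_type_algebra\<^esub> = 1"
  "\<zero>\<^bsub>ring_of_type_algebra\<^esub> = 0"
  "x \<oplus>\<^bsub>ring_of_type_algebra\<^esub> y = x + y"
  by (simp_all add: ring_of_type_algebra_def)

lemma a_inv_ring_of_type_algebra [simp]:
  "\<ominus>\<^bsub>ring_of_type_algebra\<^esub> x = - (x :: 'a::field)"
proof -
  interpret R: field "ring_of_type_algebra :: 'a ring" by (rule field_from_type_algebra)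
  show ?thesis using R.minus_equality[of "- x" x] by simp
qed

lemma m_inv_ring_of_type_algebra [simp]:
  "x \<noteq> 0 \<Longrightarrow> inv\<^bsub>ring_of_type_algebra\<^esub> x = inverse (x :: 'a::field)"
proof -
  interpret R: field "ring_of_type_algebra :: 'a ring" by (rule field_from_type_algebra)
  show "x \<noteq> 0 \<Longrightarrow> ?thesis" using R.inv_unique'[of x "inverse x"] by simp
qed

lemma nat_pow_ring_of_type_algebra [simp]:
  "x [^]\<^bsub>ring_of_type_algebra\<^esub> (n::nat) = (x :: 'a::field) ^ n"
proof -
  interpret R: field "ring_of_type_algebra :: 'a ring" by (rule field_from_type_algebra)
  show ?thesis by (induction n) simp_all
qed

text \<open>Since \<open>inverse 0 = 0\<close>, closure under \<open>inverse\<close> can be asked of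
  all elements.\<close>

lemma subfield_ring_of_type_algebra_iff:
  fixes F :: "'a::field set"
  shows "subfield F ring_of_type_algebra \<longleftrightarrow>
    0 \<in> F \<and> 1 \<in> F \<and> (\<forall>x\<in>F. \<forall>y\<in>F. x + y \<in> F \<and> x * y \<in> F) \<and> (\<forall>x\<in>F. - x \<in> F \<and> inverse x \<in> F)"
proof -
  interpret R: field "ring_of_type_algebra :: 'a ring" by (rule field_from_type_algebra)
  show ?thesis
  proof
    assume F: "subfield F ring_of_type_algebra"
    have "inverse x \<in> F" if "x \<in> F" for x
      using R.subfield_m_inv(1)[OF F, of x] that by (cases "x = 0") auto
    then show "0 \<in> F \<and> 1 \<in> F \<and> (\<forall>x\<in>F. \<forall>y\<in>F. x + y \<in> F \<and> x * y \<in> F) \<and>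
        (\<forall>x\<in>F. - x \<in> F \<and> inverse x \<in> F)"
      using subringE[OF subfieldE(1)[OF F]] by simp
  next
    assume "0 \<in> F \<and> 1 \<in> F \<and> (\<forall>x\<in>F. \<forall>y\<in>F. x + y \<in> F \<and> x * y \<in> F) \<and>
        (\<forall>x\<in>F. - x \<in> F \<and> inverse x \<in> F)"
    then show "subfield F ring_of_type_algebra"
      by (intro R.subfieldI' R.subringI) auto
  qed
qed

lemma subfield_UNIV: "subfield (UNIV :: 'a::field set) ring_of_type_algebra"
  by (simp add: subfield_ring_of_type_algebra_iff)

locale type_subfield =
  fixes F :: "'a::field set"
  assumes subfield: "subfield F ring_of_type_algebra"
begin

lemma zero_closed [simp]: "0 \<in> F" and one_closed [simp]: "1 \<in> F"
  and add_closed: "x \<in> F \<Longrightarrow> y \<in> F \<Longrightarrow> x + y \<in> F"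
  and mult_closed: "x \<in> F \<Longrightarrow> y \<in> F \<Longrightarrow> x * y \<in> F"
  and minus_closed: "x \<in> F \<Longrightarrow> - x \<in> F"
  and inverse_closed: "x \<in> F \<Longrightarrow> inverse x \<in> F"
  using subfield by (simp_all add: subfield_ring_of_type_algebra_iff)

lemma divide_closed: "x \<in> F \<Longrightarrow> y \<in> F \<Longrightarrow> x / y \<in> F"
  by (simp add: divide_inverse mult_closed inverse_closed)

lemma sum_closed: "(\<And>i. i \<in> A \<Longrightarrow> f i \<in> F) \<Longrightarrow> sum f A \<in> F"
  by (induction A rule: infinite_finite_induct) (auto intro: add_closed)

lemma polys_over_add: "p \<in> polys_over F \<Longrightarrow> q \<in> polys_over F \<Longrightarrow> p + q \<in> polys_over F"
  by (simp add: polys_over_def add_closed)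

lemma polys_over_minus: "p \<in> polys_over F \<Longrightarrow> - p \<in> polys_over F"
  by (simp add: polys_over_def minus_closed)

lemma polys_over_mult: "p \<in> polys_over F \<Longrightarrow> q \<in> polys_over F \<Longrightarrow> p * q \<in> polys_over F"
  by (simp add: polys_over_def coeff_mult sum_closed mult_closed)

lemma polys_over_pCons: "pCons c p \<in> polys_over F \<longleftrightarrow> c \<in> F \<and> p \<in> polys_over F"
  by (auto simp: polys_over_def coeff_pCons split: nat.splits)

lemma polys_over_0 [simp]: "0 \<in> polys_over F" and polys_over_1 [simp]: "1 \<in> polys_over F"
  by (simp_all add: polys_over_def)

lemma to_fract_ratfuns: "p \<in> polys_over F \<Longrightarrow> to_fract p \<in> ratfuns F"
  unfolding ratfuns_def by (intro CollectI exI[of _ p] exI[of _ 1]) simp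

lemma subfield_ratfuns: "subfield (ratfuns F) ring_of_type_algebra"
  unfolding subfield_ring_of_type_algebra_iff
proof (intro conjI ballI)
  show "0 \<in> ratfuns F" "1 \<in> ratfuns F"
    using to_fract_ratfuns[of 0] to_fract_ratfuns[of 1] by simp_all
  fix r assume "r \<in> ratfuns F"
  then obtain p q where r: "r = to_fract p / to_fract q" "p \<in> polys_over F" "q \<in> polys_over F" "q \<noteq> 0"
    unfolding ratfuns_def by blast
  have "- r = to_fract (- p) / to_fract q"
    by (simp add: r)
  with r show "- r \<in> ratfuns F"
    unfolding ratfuns_def using polys_over_minus by blast
  show "inverse r \<in> ratfuns F"
  proof (cases "p = 0")
    case True
    then show ?thesis using r to_fract_ratfuns[of 0] by simp
  next
    case False
    then show ?thesis using r unfolding ratfuns_def by auto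
  qed
  fix s assume "s \<in> ratfuns F"
  then obtain p' q' where s: "s = to_fract p' / to_fract q'" "p' \<in> polys_over F" "q' \<in> polys_over F"
      "q' \<noteq> 0"
    unfolding ratfuns_def by blast
  have "r + s = to_fract (p * q' + p' * q) / to_fract (q * q')"
    using r s by (simp add: add_frac_eq)
  moreover have "r * s = to_fract (p * p') / to_fract (q * q')"
    using r s by simp
  moreover have "p * q' + p' * q \<in> polys_over F" "p * p' \<in> polys_over F" "q * q' \<in> polys_over F" "q * q' \<noteq> 0"
    using r s by (simp_all add: polys_over_add polys_over_mult)
  ultimately show "r + s \<in> ratfuns F" "r * s \<in> ratfuns F"
    unfolding ratfuns_def by blast+
qed

end

lemma ratfuns_mono: "F \<subseteq> G \<Longrightarrow> ratfuns F \<subseteq> ratfuns G"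
  unfolding ratfuns_def polys_over_def by blast

lemma polys_over_UNIV [simp]: "polys_over UNIV = UNIV"
  by (simp add: polys_over_def)

lemma fract_eq_to_fract_divide:
  obtains p q where "r = to_fract p / to_fract q" "q \<noteq> 0"
  by (cases r rule: Fract_cases) (simp add: Fract_conv_to_fract)

lemma ratfuns_UNIV [simp]: "ratfuns UNIV = UNIV"
proof -
  have "r \<in> ratfuns UNIV" for r :: "'a poly fract"
    by (rule fract_eq_to_fract_divide[of r]) (auto simp: ratfuns_def)
  then show ?thesis by blast
qed

section \<open>The valuation of a pair on rational functions\<close>

context krull_valuation
begin

text \<open>The choice in \<open>pair_val\<close> is unambiguous: cross-multiplying two
  representations and using additivity of \<open>pair_val_poly\<close> gives equal differences. As
  \<open>a\<close> lies in \<open>F\<close>, the shifted coefficients stay in \<open>F\<close>,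
  where \<open>v\<close> and \<open>w\<close> agree.\<close>

lemma pair_val_eq:
  assumes F: "subfield F ring_of_type_algebra" and a: "a \<in> F"
    and v: "\<And>x. x \<in> F - {0} \<Longrightarrow> v x = w x"
    and pq: "p \<in> polys_over F" "q \<in> polys_over F" "p \<noteq> 0" "q \<noteq> 0"
  shows "pair_val F v a \<gamma> (to_fract p / to_fract q) = pair_val_poly w a \<gamma> p - pair_val_poly w a \<gamma> q"
proof -
  interpret F: type_subfield F by (rule type_subfield.intro[OF F])
  have eq: "pair_val_poly v a \<gamma> f = pair_val_poly w a \<gamma> f" if f: "f \<in> polys_over F" for f
  proof -
    have "poly.coeff (pcompose f [:a, 1:]) i \<in> F" for i
      by (rule coeff_pcompose_semiring_closed)
        (use f a in \<open>auto simp: polys_over_def coeff_pCons F.add_closed F.mult_closed split: nat.splits\<close>)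
    then show ?thesis
      unfolding pair_val_poly_eq_gauss_val by (intro gauss_val_cong v) simp
  qed
  show ?thesis
    unfolding pair_val_def
  proof (rule some_equality)
    show "\<exists>p'\<in>polys_over F. \<exists>q'\<in>polys_over F. p' \<noteq> 0 \<and> q' \<noteq> 0 \<and>
        to_fract p / to_fract q = to_fract p' / to_fract q' \<and>
        pair_val_poly w a \<gamma> p - pair_val_poly w a \<gamma> q = pair_val_poly v a \<gamma> p' - pair_val_poly v a \<gamma> q'"
      using pq eq by metis
  next
    fix \<delta>
    assume "\<exists>p'\<in>polys_over F. \<exists>q'\<in>polys_over F. p' \<noteq> 0 \<and> q' \<noteq> 0 \<and>
        to_fract p / to_fract q = to_fract p' / to_fract q' \<and>
        \<delta> = pair_val_poly v a \<gamma> p' - pair_val_poly v a \<gamma> q'"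
    then obtain p' q' where *: "p' \<in> polys_over F" "q' \<in> polys_over F" "p' \<noteq> 0" "q' \<noteq> 0"
        "to_fract p / to_fract q = to_fract p' / to_fract q'"
        "\<delta> = pair_val_poly w a \<gamma> p' - pair_val_poly w a \<gamma> q'"
      using eq by auto
    then have "to_fract (p * q') = to_fract (p' * q)"
      using pq by (simp add: frac_eq_eq)
    then have "p * q' = p' * q" by (simp only: to_fract_eq_iff)
    then have "pair_val_poly w a \<gamma> p + pair_val_poly w a \<gamma> q' = pair_val_poly w a \<gamma> p' + pair_val_poly w a \<gamma> q"
      using pair_val_poly_mult * pq by metis
    then show "\<delta> = pair_val_poly w a \<gamma> p - pair_val_poly w a \<gamma> q"
      unfolding * by (simp add: algebra_simps)
  qed
qed

abbreviation ratval :: "'a \<Rightarrow> 'g \<Rightarrow> 'a poly fract \<Rightarrow> 'g" where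
  "ratval \<equiv> pair_val UNIV w"

lemma ratval_divide:
  "p \<noteq> 0 \<Longrightarrow> q \<noteq> 0 \<Longrightarrow>
     ratval a \<gamma> (to_fract p / to_fract q) = pair_val_poly w a \<gamma> p - pair_val_poly w a \<gamma> q"
  by (rule pair_val_eq[OF subfield_UNIV]) auto

lemma pair_val_poly_1 [simp]: "pair_val_poly w a \<gamma> 1 = 0"
  using pair_val_poly_const[of 1 a \<gamma>] by (simp add: one_pCons)

lemma ratval_to_fract: "p \<noteq> 0 \<Longrightarrow> ratval a \<gamma> (to_fract p) = pair_val_poly w a \<gamma> p"
  using ratval_divide[of p 1 a \<gamma>] by simp

lemma ratval_const: "c \<noteq> 0 \<Longrightarrow> ratval a \<gamma> (const_fract c) = w c"
  by (simp add: const_fract_def ratval_to_fract pair_val_poly_const)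

text \<open>Allows valuations over different subfields to be compared inside a single one on the
  ambient rational function field.\<close>

lemma pair_val_eq_ratval:
  assumes "subfield F ring_of_type_algebra" "a \<in> F" "\<And>x. x \<in> F - {0} \<Longrightarrow> v x = w x"
    and r: "r \<in> ratfuns F - {0}"
  shows "pair_val F v a \<gamma> r = ratval a \<gamma> r"
proof -
  obtain p q where "r = to_fract p / to_fract q" "p \<in> polys_over F" "q \<in> polys_over F" "q \<noteq> 0" "p \<noteq> 0"
    using r unfolding ratfuns_def by fastforce
  then show ?thesis using pair_val_eq[OF assms(1,2), of v p q \<gamma>] assms(3) ratval_divide by simp
qed

lemma ratval_translate:
  assumes "ge \<gamma> (b - a)" "r \<noteq> 0"
  shows "ratval b \<gamma> r = ratval a \<gamma> r"
proof -
  obtain p q where "r = to_fract p / to_fract q" "q \<noteq> 0" by (rule fract_eq_to_fract_divide)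
  with assms show ?thesis by (auto simp: ratval_divide pair_val_poly_translate)
qed

lemma krull_valuation_ratval: "krull_valuation (ratval a \<gamma>)"
proof
  fix r s :: "'a poly fract"
  assume nz: "r \<noteq> 0" "s \<noteq> 0"
  obtain p q where r: "r = to_fract p / to_fract q" "q \<noteq> 0" by (rule fract_eq_to_fract_divide)
  obtain p' q' where s: "s = to_fract p' / to_fract q'" "q' \<noteq> 0" by (rule fract_eq_to_fract_divide)
  have nz': "p \<noteq> 0" "p' \<noteq> 0" using nz r s by auto
  have "r * s = to_fract (p * p') / to_fract (q * q')"
    using r s by simp
  then have "ratval a \<gamma> (r * s) = pair_val_poly w a \<gamma> (p * p') - pair_val_poly w a \<gamma> (q * q')"
    using ratval_divide[of "p * p'" "q * q'"] nz' r s by simp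
  then show "ratval a \<gamma> (r * s) = ratval a \<gamma> r + ratval a \<gamma> s"
    using nz' r s by (simp add: ratval_divide pair_val_poly_mult)
  assume "r + s \<noteq> 0"
  have rs: "r + s = to_fract (p * q' + p' * q) / to_fract (q * q')"
    using r s by (simp add: add_frac_eq)
  have nz'': "p * q' + p' * q \<noteq> 0"
  proof
    assume "p * q' + p' * q = 0"
    from rs[unfolded this] \<open>r + s \<noteq> 0\<close> show False by simp
  qed
  have "min (pair_val_poly w a \<gamma> (p * q')) (pair_val_poly w a \<gamma> (p' * q))
      \<le> pair_val_poly w a \<gamma> (p * q' + p' * q)"
    using nz' nz'' r s by (intro pair_val_poly_add) auto
  \<comment> \<open>Both values are brought over the common denominator
    \<open>q * q'\<close>.\<close>
  moreover have min_eq: "min (x - y) (x' - y') = min (x + y') (x' + y) - (y + y')" for x y x' y' :: 'g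
    by (simp add: min_diff_distrib_left)
  moreover have "ratval a \<gamma> (r + s) = pair_val_poly w a \<gamma> (p * q' + p' * q) - pair_val_poly w a \<gamma> (q * q')"
    unfolding rs using nz'' r s by (intro ratval_divide) auto
  ultimately show "min (ratval a \<gamma> r) (ratval a \<gamma> s) \<le> ratval a \<gamma> (r + s)"
    using nz' r s by (simp add: ratval_divide pair_val_poly_mult min_eq)
qed

end

section \<open>Degrees of algebraic elements\<close>

text \<open>The polynomials of \<open>univ_poly\<close> are lists with the leading coefficient
  first, hence \<open>rev\<close>.\<close>

lemma eval_eq_poly:
  "ring.eval ring_of_type_algebra p (x :: 'a::field) = poly (Poly (rev p)) x"
proof -
  interpret R: field "ring_of_type_algebra :: 'a ring" by (rule field_from_type_algebra)
  show ?thesis by (induction p) (simp_all add: Poly_snoc poly_monom)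
qed

lemma (in type_subfield) carrier_univ_poly:
  "p \<in> carrier (univ_poly ring_of_type_algebra F) \<longleftrightarrow> p = [] \<or> set p \<subseteq> F \<and> hd p \<noteq> 0"
  by (simp add: univ_poly_def polynomial_def)

lemma (in type_subfield) poly_of_list:
  assumes "p \<in> carrier (univ_poly ring_of_type_algebra F)"  "p \<noteq> []"
  shows "Poly (rev p) \<in> polys_over F" "Poly (rev p) \<noteq> 0" "Polynomial.degree (Poly (rev p)) = length p - 1"
    "poly.coeff (Poly (rev p)) (length p - 1) = hd p"
proof -
  have p: "set p \<subseteq> F" "hd p \<noteq> 0"
    using assms carrier_univ_poly by auto
  show "Poly (rev p) \<in> polys_over F"
    using p(1) by (auto simp: polys_over_def nth_default_def) (metis length_rev nth_mem set_rev subsetD)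
  show "poly.coeff (Poly (rev p)) (length p - 1) = hd p"
    using assms(2) by (simp add: nth_default_def rev_nth hd_conv_nth)
  then have nz: "poly.coeff (Poly (rev p)) (length p - 1) \<noteq> 0"
    using p(2) by simp
  then show "Poly (rev p) \<noteq> 0"
    by (metis coeff_0)
  have "Polynomial.degree (Poly (rev p)) \<le> length p - 1"
    by (rule degree_le) (auto simp: nth_default_def)
  then show "Polynomial.degree (Poly (rev p)) = length p - 1"
    using le_degree[OF nz] by simp
qed

lemma (in type_subfield) list_of_poly:
  assumes "p \<in> polys_over F" "p \<noteq> 0"
  shows "rev (coeffs p) \<in> carrier (univ_poly ring_of_type_algebra F)" "rev (coeffs p) \<noteq> []"
proof -
  have "range (poly.coeff p) \<subseteq> F"
    using assms(1) by (auto simp: polys_over_def)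
  then have "set (coeffs p) \<subseteq> F"
    unfolding range_coeff by simp
  then show "rev (coeffs p) \<in> carrier (univ_poly ring_of_type_algebra F)" "rev (coeffs p) \<noteq> []"
    using assms(2) by (simp_all add: carrier_univ_poly hd_rev last_coeffs_eq_coeff_degree)
qed

lemma (in type_subfield) algebraic_iff:
  "ring.algebraic ring_of_type_algebra F x \<longleftrightarrow> (\<exists>p\<in>polys_over F. p \<noteq> 0 \<and> poly p x = 0)"
proof -
  interpret R: field "ring_of_type_algebra :: 'a ring" by (rule field_from_type_algebra)
  show ?thesis
  proof
    assume "R.algebraic F x"
    then obtain p where "p \<in> carrier (univ_poly ring_of_type_algebra F)" "p \<noteq> []" "R.eval p x = 0"
      using R.algebraicE[OF subfieldE(1)[OF subfield], of x] by (auto simp: over_def)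
    then show "\<exists>p\<in>polys_over F. p \<noteq> 0 \<and> poly p x = 0"
      using poly_of_list[of p] by (auto simp: eval_eq_poly)
  next
    assume "\<exists>p\<in>polys_over F. p \<noteq> 0 \<and> poly p x = 0"
    then obtain p where "p \<in> polys_over F" "p \<noteq> 0" "poly p x = 0" by blast
    then show "R.algebraic F x"
      using R.algebraicI[OF list_of_poly, of p x] by (simp add: eval_eq_poly over_def)
  qed
qed

text \<open>For algebraic \<open>x\<close> the ring \<open>F[x]\<close> is already the field
  \<open>F(x)\<close>; its dimension is the degree of the minimal polynomial, one less than the
  length of its list.\<close>

lemma (in type_subfield) simple_degree_eq:
  assumes "ring.algebraic ring_of_type_algebra F x"
  shows "simple_degree F x = length (ring.Irr ring_of_type_algebra F x) - 1"
proof -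
  interpret R: field "ring_of_type_algebra :: 'a ring" by (rule field_from_type_algebra)
  have alg: "(R.algebraic over F) x" using assms by (simp add: over_def)
  have "R.simple_extension F x = generate_field ring_of_type_algebra (insert x F)"
  proof (rule R.generate_fieldI)
    show "subfield (R.simple_extension F x) ring_of_type_algebra"
      using R.simple_extension_is_subfield[OF subfield] alg by simp
    show "insert x F \<subseteq> R.simple_extension F x"
      using R.simple_extension_mem[OF subfieldE(1)[OF subfield], of x] R.simple_extension_incl[of F x] by simp
    show "R.simple_extension F x \<subseteq> G" if "subfield G ring_of_type_algebra" "insert x F \<subseteq> G" for G
      using R.simple_extension_subring_incl[OF subfieldE(1)[OF that(1)], of F x] that(2) by simp
  qed simp
  then show ?thesis
    using R.simple_extension_dim[OF subfield _ alg] by (simp add: simple_degree_def over_def)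
qed

text \<open>The minimal polynomial of \<open>x\<close> divides \<open>p\<close>.\<close>

lemma (in type_subfield) simple_degree_le:
  assumes "p \<in> polys_over F" "p \<noteq> 0" "poly p x = 0"
  shows "simple_degree F x \<le> Polynomial.degree p"
proof -
  interpret R: field "ring_of_type_algebra :: 'a ring" by (rule field_from_type_algebra)
  have "R.algebraic F x" using assms algebraic_iff by blast
  then have alg: "(R.algebraic over F) x" by (simp add: over_def)
  note l = list_of_poly[OF assms(1,2)]
  have "R.Irr F x pdivides\<^bsub>ring_of_type_algebra\<^esub> rev (coeffs p)"
    by (rule R.Irr_minimal[OF subfield _ alg l(1)]) (simp_all add: eval_eq_poly assms)
  then have "length (R.Irr F x) - 1 \<le> length (rev (coeffs p)) - 1"
    by (intro R.pdivides_imp_degree_le[OF subfieldE(1)[OF subfield] R.IrrE(1)[OF subfield _ alg] l(1) l(2)]) simp_all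
  then show ?thesis
    using simple_degree_eq \<open>R.algebraic F x\<close> by (simp add: degree_eq_length_coeffs)
qed

lemma (in type_subfield) monic_poly_of_simple_degree:
  assumes "ring.algebraic ring_of_type_algebra F x"
  obtains p where "p \<in> polys_over F" "Polynomial.degree p = simple_degree F x"
    "poly.coeff p (Polynomial.degree p) = 1" "poly p x = 0"
proof -
  interpret R: field "ring_of_type_algebra :: 'a ring" by (rule field_from_type_algebra)
  have alg: "(R.algebraic over F) x" using assms by (simp add: over_def)
  let ?q = "R.Irr F x"
  have q: "?q \<in> carrier (univ_poly ring_of_type_algebra F)" "hd ?q = 1" "R.eval ?q x = 0"
    using R.IrrE[OF subfield _ alg] by simp_all
  have "?q \<noteq> []"
    using R.IrrE(2)[OF subfield _ alg] R.pirreducibleE(1)[OF subfieldE(1)[OF subfield] q(1)]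
    by simp
  with q poly_of_list[OF q(1)] show ?thesis
    using that[of "Poly (rev ?q)"] simple_degree_eq[OF assms] by (simp add: eval_eq_poly)
qed

section \<open>Approximation from a dense subfield\<close>

text \<open>Splitting off one root at a time writes \<open>poly p b\<close> as a product of
  differences \<open>b - c\<close>, each of value less than \<gamma>. Used in contrapositive form: a
  large value at \<open>b\<close> forces a root near \<open>b\<close>. The strict bound fails at
  degree \<open>0\<close>, where \<open>p = 1\<close>, so the induction carries the weak one
  along.\<close>

lemma (in krull_valuation) poly_far_from_roots:
  fixes p :: "'a poly"
  assumes alg_closed: "\<And>q :: 'a poly. Polynomial.degree q > 0 \<Longrightarrow> \<exists>x. poly q x = 0"
  shows "Polynomial.degree p = n \<Longrightarrow> poly.coeff p n = 1 \<Longrightarrow> (\<And>c. poly p c = 0 \<Longrightarrow> \<not> ge \<gamma> (b - c)) \<Longrightarrow>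
     poly p b \<noteq> 0 \<and> w (poly p b) \<le> n \<cdot> \<gamma> \<and> (0 < n \<longrightarrow> w (poly p b) < n \<cdot> \<gamma>)"
proof (induction n arbitrary: p)
  case 0
  then obtain c where "p = [:c:]" by (metis degree_eq_zeroE)
  with 0 show ?case by simp
next
  case (Suc n)
  then obtain c where c: "poly p c = 0" using alg_closed[of p] by auto
  then obtain q where q: "p = [:- c, 1:] * q" unfolding poly_eq_0_iff_dvd by (auto elim: dvdE)
  then have "q \<noteq> 0" using Suc.prems(1) by auto
  have "Polynomial.degree p = 1 + Polynomial.degree q"
    unfolding q using \<open>q \<noteq> 0\<close> by (subst degree_mult_eq) auto
  then have n: "Polynomial.degree q = n" using Suc.prems(1) by simp
  have "poly.coeff p (Suc n) = poly.coeff q n"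
    by (simp add: q coeff_eq_0 n)
  then have "poly.coeff q n = 1" using Suc.prems(2) by simp
  with Suc.IH[OF n] Suc.prems(3) have IH: "poly q b \<noteq> 0" "w (poly q b) \<le> n \<cdot> \<gamma>"
    by (auto simp: q)
  have bc: "b - c \<noteq> 0" "w (b - c) < \<gamma>"
    using Suc.prems(3)[OF c] by (auto simp: ge_def)
  have "poly p b = poly q b * (b - c)" by (simp add: q algebra_simps)
  with bc IH have "poly p b \<noteq> 0" "w (poly p b) = w (poly q b) + w (b - c)"
    by (simp_all add: mult)
  with add_le_less_mono[OF IH(2) bc(2)] show ?case by simp
qed

lemma (in type_subfield) poly_with_coeffs:
  assumes "\<And>i. i \<le> n \<Longrightarrow> \<exists>z\<in>F. P i z"
  obtains g where "g \<in> polys_over F" "Polynomial.degree g \<le> n" "\<And>i. i \<le> n \<Longrightarrow> P i (poly.coeff g i)"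
proof -
  obtain z where z: "\<And>i. i \<le> n \<Longrightarrow> z i \<in> F \<and> P i (z i)"
    using assms by metis
  have coeff: "poly.coeff (Poly (map z [0..<Suc n])) i = (if i \<le> n then z i else 0)" for i
    by (simp add: nth_default_def del: upt_Suc)
  show ?thesis
    by (rule that[of "Poly (map z [0..<Suc n])"])
      (use z in \<open>auto simp: polys_over_def coeff simp del: coeff_Poly_eq upt_Suc intro: degree_le\<close>)
qed

text \<open>Models a field \<open>K\<close> inside its completion \<open>L\<close>, with the ambient
  type as an algebraic closure of \<open>L\<close>.\<close>

locale dense_subfield = krull_valuation w + K: type_subfield K + L: type_subfield L
  for w :: "'a::alg_closed_field \<Rightarrow> 'g::linordered_ab_group_add" and K L :: "'a set" +
  assumes subset: "K \<subseteq> L"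
    and dense: "x \<in> L \<Longrightarrow> y \<in> L - {0} \<Longrightarrow> \<exists>z\<in>K. gt (w y) (x - z)"
    and algebraic: "\<exists>p\<in>polys_over L. p \<noteq> 0 \<and> poly p x = 0"
begin

text \<open>Expresses cofinality of the value group of \<open>K\<close>: dominated bounds are the
  precisions to which density lets elements of \<open>L\<close> be approximated from
  \<open>K\<close>.\<close>

definition dominated :: "'g \<Rightarrow> bool" where "dominated \<delta> \<longleftrightarrow> (\<exists>x\<in>K - {0}. \<delta> \<le> w x)"

lemma dominated_mono: "dominated \<delta> \<Longrightarrow> \<epsilon> \<le> \<delta> \<Longrightarrow> dominated \<epsilon>"
  unfolding dominated_def by (meson order_trans)

lemma dominated_add: "dominated \<delta> \<Longrightarrow> dominated \<epsilon> \<Longrightarrow> dominated (\<delta> + \<epsilon>)"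
proof -
  assume "dominated \<delta>" "dominated \<epsilon>"
  then obtain x y where "x \<in> K" "y \<in> K" "x \<noteq> 0" "y \<noteq> 0" "\<delta> \<le> w x" "\<epsilon> \<le> w y"
    unfolding dominated_def by blast
  then show "dominated (\<delta> + \<epsilon>)"
    unfolding dominated_def by (intro bexI[of _ "x * y"]) (auto simp: mult add_mono K.mult_closed)
qed

lemma dominated_0 [simp]: "dominated 0"
  unfolding dominated_def by (rule bexI[of _ 1]) auto

lemma dominated_nat_mult: "dominated \<delta> \<Longrightarrow> dominated (n \<cdot> \<delta>)"
  by (induction n) (auto intro: dominated_add)

lemma approx:
  assumes "x \<in> L" "dominated \<delta>"
  shows "\<exists>z\<in>K. gt \<delta> (x - z)"
proof -
  obtain y where "y \<in> K - {0}" "\<delta> \<le> w y" using assms(2) unfolding dominated_def by blast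
  then show ?thesis using dense[OF assms(1), of y] subset gt_mono by blast
qed

text \<open>An element of \<open>K\<close> that approximates \<open>x\<close> beyond
  \<open>w x\<close> has the same value as \<open>x\<close>.\<close>

lemma dominated_L:
  assumes "x \<in> L - {0}"
  shows "dominated (w x)"
proof -
  obtain z where "z \<in> K" "gt (w x) (x - z)" using dense[of x x] assms by blast
  then show ?thesis using eq_of_gt_diff[of x z] assms unfolding dominated_def by (intro bexI[of _ z]) auto
qed

text \<open>Suppose \<open>w x\<close> exceeds all values of \<open>K\<close>. In a polynomial over
  \<open>L\<close> with root \<open>x\<close> and nonzero constant term, every other term at
  \<open>x\<close> would have greater value than the constant term, so the sum could not
  vanish.\<close>

lemma dominated_val:
  assumes "x \<noteq> 0"
  shows "dominated (w x)"
proof (rule ccontr)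
  assume unbounded: "\<not> dominated (w x)"
  then have pos: "0 < w x"
    using dominated_mono[OF dominated_0] by (metis not_le)
  \<comment> \<open>Factors \<open>X\<close> can be divided out without losing the root, because
    \<open>x\<close> is nonzero.\<close>
  obtain p where p: "p \<in> polys_over L" "p \<noteq> 0" "poly p x = 0" "poly.coeff p 0 \<noteq> 0"
  proof -
    obtain p where p: "p \<in> polys_over L" "p \<noteq> 0" "poly p x = 0" using algebraic by blast
    then show ?thesis using that
    proof (induction p rule: pCons_induct)
      case (pCons c p)
      show ?case
      proof (cases "c = 0")
        case True
        then show ?thesis using pCons assms by (auto simp: L.polys_over_pCons)
      next
        case False
        then show ?thesis using pCons.prems by (metis coeff_pCons_0)
      qed
    qed simp
  qed
  obtain q where pq: "p = pCons (poly.coeff p 0) q"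
    by (metis coeff_pCons_0 pCons_cases)
  have q: "poly.coeff q i \<in> L" for i
    using p(1) pq unfolding polys_over_def by (metis (mono_tags) coeff_pCons_Suc mem_Collect_eq)
  let ?c = "poly.coeff p 0"
  have c: "?c \<in> L - {0}" using p by (simp add: polys_over_def)
  have "gt (w ?c) (poly.coeff q i * x ^ Suc i)" for i
  proof (cases "poly.coeff q i = 0")
    case False
    \<comment> \<open>The left side is the value of a quotient in \<open>L\<close> and therefore
      dominated, whereas \<open>w x\<close> is not.\<close>
    have "w ?c - w (poly.coeff q i) < w x"
    proof (rule ccontr)
      assume "\<not> ?thesis"
      then have "w x \<le> w (?c / poly.coeff q i)"
        using False c by (simp add: divide)
      moreover have "dominated (w (?c / poly.coeff q i))"
        using False c q by (intro dominated_L) (simp add: L.divide_closed)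
      ultimately show False using unbounded dominated_mono by blast
    qed
    moreover have "0 \<le> i \<cdot> w x" using pos by (intro sum_nonneg) simp
    then have "w x \<le> w (x ^ Suc i)" using assms by (simp add: power del: power_Suc)
    ultimately have "w ?c < w (poly.coeff q i) + w (x ^ Suc i)"
      by (metis diff_less_eq add.commute less_le_trans)
    then show ?thesis using False assms by (simp add: gt_def mult del: power_Suc)
  qed simp
  then have "gt (w ?c) (\<Sum>i\<le>Polynomial.degree q. poly.coeff q i * x ^ Suc i)"
    by (intro gt_sum)
  moreover have "(\<Sum>i\<le>Polynomial.degree q. poly.coeff q i * x ^ Suc i) = x * poly q x"
    by (simp add: poly_altdef sum_distrib_left mult_ac)
  ultimately have "poly p x \<noteq> 0"
    using eq_add_gt(1)[of ?c "x * poly q x"] c by (subst pq) simp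
  with p show False by simp
qed

lemma dominated_minus_val: "x \<noteq> 0 \<Longrightarrow> dominated (- w x)"
  using dominated_val[of "inverse x"] by (simp add: inverse)

text \<open>
  Replacing the coefficients of \<open>h\<close> by close elements of \<open>K\<close> makes the value of the polynomial at
  \<open>b\<close> large; as this value is the product of the distances of \<open>b\<close> to the new roots, one of them
  is close to \<open>b\<close>.
\<close>

lemma near_algebraic:
  assumes \<gamma>: "dominated \<gamma>" and h: "h \<in> polys_over L" "poly.coeff h (Polynomial.degree h) = 1" "poly h b = 0"
  obtains g c where "g \<in> polys_over K" "g \<noteq> 0" "Polynomial.degree g \<le> Polynomial.degree h"
    "poly g c = 0" "ge \<gamma> (b - c)"
proof -
  define n where "n = Polynomial.degree h"
  \<comment> \<open>The tolerance is put on the products with \<open>b ^ i\<close>, so that the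
    errors at \<open>b\<close> add up to value at least \<open>n \<cdot> \<gamma>\<close>. Fixing
    the leading coefficient keeps the polynomial monic of degree \<open>n\<close>.\<close>
  let ?P = "\<lambda>i z. (i = n \<longrightarrow> z = 1) \<and> ge (n \<cdot> \<gamma>) ((poly.coeff h i - z) * b ^ i)"
  have "\<exists>z\<in>K. ?P i z" if "i \<le> n" for i
  proof (cases "i = n \<or> b ^ i = 0")
    case True
    then show ?thesis using h(2) n_def by (intro bexI[of _ 1]) (auto simp del: power_eq_0_iff)
  next
    case False
    have "dominated (n \<cdot> \<gamma> - w (b ^ i))"
      using dominated_add[OF dominated_nat_mult[OF \<gamma>] dominated_minus_val, of "b ^ i" n] False by simp
    then obtain z where z: "z \<in> K" "gt (n \<cdot> \<gamma> - w (b ^ i)) (poly.coeff h i - z)"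
      using approx h(1) unfolding polys_over_def by blast
    have "gt (n \<cdot> \<gamma>) ((poly.coeff h i - z) * b ^ i)"
      using gt_mult_nonzero[OF z(2), of "b ^ i"] False by simp
    then have "ge (n \<cdot> \<gamma>) ((poly.coeff h i - z) * b ^ i)"
      unfolding gt_def ge_def by auto
    with z(1) False show ?thesis by blast
  qed
  then obtain g where g: "g \<in> polys_over K" "Polynomial.degree g \<le> n" "\<And>i. i \<le> n \<Longrightarrow> ?P i (poly.coeff g i)"
    using K.poly_with_coeffs[of n ?P] by metis
  have lead: "poly.coeff g n = 1" using g(3)[of n] by simp
  then have deg: "Polynomial.degree g = n" using g(2) le_degree[of g n] by simp
  have "poly h b - poly g b = (\<Sum>i\<le>n. (poly.coeff h i - poly.coeff g i) * b ^ i)"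
    by (simp add: poly_altdef deg n_def[symmetric] left_diff_distrib sum_subtractf)
  moreover have "ge (n \<cdot> \<gamma>) (\<Sum>i\<le>n. (poly.coeff h i - poly.coeff g i) * b ^ i)"
    by (intro ge_sum) (use g(3) in auto)
  ultimately have "ge (n \<cdot> \<gamma>) (poly g b)" using h(3) by (metis diff_0 ge_minus)
  \<comment> \<open>The strict bound in \<open>poly_far_from_roots\<close> requires positive degree;
    a monic constant would have no root.\<close>
  moreover have "0 < n"
  proof (rule ccontr)
    assume "\<not> 0 < n"
    then have "h = 1" using h(2) unfolding n_def by (metis degree_eq_zeroE coeff_pCons_0 gr0I one_pCons)
    with h(3) show False by simp
  qed
  ultimately obtain c where "poly g c = 0" "ge \<gamma> (b - c)"
    using poly_far_from_roots[OF alg_closed_imp_poly_has_root deg lead, of \<gamma> b]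
    unfolding ge_def by (metis not_le)
  then show ?thesis using that[of g c] g deg lead n_def by force
qed

text \<open>In the expansion of \<open>f\<close> in powers of \<open>X - a\<close> the constant term
  \<open>poly f a\<close> vanishes, so the minimum is attained at some index
  \<open>i = Suc j\<close>. For positive \<gamma> this bounds \<gamma> by the value of
  \<open>f\<close> minus that of a coefficient.\<close>

lemma dominated_gamma:
  assumes f: "f \<noteq> 0" "poly f a = 0" and dominated: "dominated (pair_val_poly w a \<gamma> f)"
  shows "dominated \<gamma>"
proof (cases "\<gamma> \<le> 0")
  case True
  then show ?thesis using dominated_0 dominated_mono by blast
next
  case False
  let ?g = "pcompose f [:a, 1:]"
  have "?g \<noteq> 0" using f by (simp add: pcompose_eq_0_iff)
  then obtain i where i: "poly.coeff ?g i \<noteq> 0" "pair_val_poly w a \<gamma> f = w (poly.coeff ?g i) + i \<cdot> \<gamma>"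
    unfolding pair_val_poly_eq_gauss_val by (rule gauss_val_attained)
  have "poly.coeff ?g 0 = 0" using f by simp
  with i(1) obtain j where j: "i = Suc j" by (metis not0_implies_Suc)
  have "0 \<le> j \<cdot> \<gamma>" using False by (intro sum_nonneg) simp
  then have "\<gamma> \<le> pair_val_poly w a \<gamma> f + - w (poly.coeff ?g i)"
    unfolding i(2) j by simp
  then show ?thesis using dominated_add[OF dominated dominated_minus_val[OF i(1)]] dominated_mono by blast
qed

lemma dominated_pair_val_poly:
  assumes "dominated \<gamma>" "f \<noteq> 0"
  shows "dominated (pair_val_poly w a \<gamma> f)"
proof -
  have "pcompose f [:a, 1:] \<noteq> 0" using assms by (simp add: pcompose_eq_0_iff)
  then obtain i where "poly.coeff (pcompose f [:a, 1:]) i \<noteq> 0"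
      "pair_val_poly w a \<gamma> f = w (poly.coeff (pcompose f [:a, 1:]) i) + i \<cdot> \<gamma>"
    unfolding pair_val_poly_eq_gauss_val by (rule gauss_val_attained)
  then show ?thesis using dominated_add dominated_val dominated_nat_mult assms by metis
qed

text \<open>Coefficients are approximated with respect to powers of \<open>X\<close> rather than
  \<open>X - a\<close>, since \<open>a\<close> need not lie in \<open>L\<close>. The error in
  coefficient \<open>i\<close> must exceed \<open>u (to_fract f)\<close> minus \<open>i\<close>
  times the value of \<open>X\<close>; the bound on the negated value of \<open>X\<close> makes this
  precision dominated.\<close>

lemma approx_poly:
  fixes a :: 'a and \<gamma> :: 'g
  defines "u \<equiv> ratval a \<gamma>"
  assumes \<gamma>: "dominated \<gamma>" and X: "dominated (- u (to_fract [:0, 1:]))"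
    and f: "f \<in> polys_over L" "f \<noteq> 0"
  shows "\<exists>g\<in>polys_over K. krull_valuation.gt u (u (to_fract f)) (to_fract f - to_fract g)"
proof -
  interpret U: krull_valuation u unfolding u_def by (rule krull_valuation_ratval)
  let ?X = "to_fract [:0, 1:] :: 'a poly fract"
  have pCons_0: "to_fract (pCons 0 p) = ?X * to_fract p" for p :: "'a poly"
    by (simp flip: to_fract_mult)
  have monom: "to_fract (monom c i) = const_fract c * ?X ^ i" for c i
  proof (induction i)
    case (Suc i)
    then show ?case
      unfolding monom_Suc pCons_0[of "monom c i"] by (simp add: mult_ac)
  qed (simp add: monom_0 const_fract_def)
  let ?n = "Polynomial.degree f"
  let ?P = "\<lambda>i z. gt (u (to_fract f) - i \<cdot> u ?X) (poly.coeff f i - z)"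
  have "\<exists>z\<in>K. ?P i z" for i
  proof (rule approx)
    show "poly.coeff f i \<in> L" using f by (simp add: polys_over_def)
    have "dominated (u (to_fract f))"
      using dominated_pair_val_poly[OF \<gamma> f(2)] f(2) by (simp add: u_def ratval_to_fract)
    then show "dominated (u (to_fract f) - i \<cdot> u ?X)"
      using dominated_add[OF _ dominated_nat_mult[OF X], of _ i] by (simp add: sum_negf)
  qed
  then obtain g where g: "g \<in> polys_over K" "Polynomial.degree g \<le> ?n" "\<And>i. i \<le> ?n \<Longrightarrow> ?P i (poly.coeff g i)"
    using K.poly_with_coeffs[of ?n ?P] by metis
  have "f - g = (\<Sum>i\<le>?n. monom (poly.coeff f i - poly.coeff g i) i)"
    using poly_as_sum_of_monoms'[of "f - g" ?n] g(2) by (simp add: degree_diff_le)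
  then have "to_fract f - to_fract g = (\<Sum>i\<le>?n. const_fract (poly.coeff f i - poly.coeff g i) * ?X ^ i)"
    by (simp add: monom flip: to_fract_diff)
  moreover have "U.gt (u (to_fract f)) (const_fract (poly.coeff f i - poly.coeff g i) * ?X ^ i)"
    if "i \<le> ?n" for i
  proof (cases "poly.coeff f i = poly.coeff g i")
    case True
    then show ?thesis by (simp add: const_fract_def)
  next
    case False
    then have "const_fract (poly.coeff f i - poly.coeff g i) \<noteq> 0" "?X ^ i \<noteq> 0"
      and "u (const_fract (poly.coeff f i - poly.coeff g i)) = w (poly.coeff f i - poly.coeff g i)"
      by (simp_all add: const_fract_def u_def ratval_const[unfolded const_fract_def])
    then show ?thesis
      using g(3)[OF that] False
      by (simp add: U.gt_def gt_def U.mult U.power diff_less_eq)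
  qed
  ultimately have "U.gt (u (to_fract f)) (to_fract f - to_fract g)"
    by (metis (no_types, lifting) U.gt_sum atMost_iff)
  with g(1) show ?thesis by blast
qed

text \<open>Numerator and denominator are approximated separately. In
  \<open>p/q - p'/q' = ((p - p') * q' - (q - q') * p') / (q * q')\<close> the approximants have the
  values of \<open>p\<close> and \<open>q\<close>, so the error has value beyond that of
  \<open>p/q\<close>.\<close>

lemma approx_ratfun:
  fixes a :: 'a and \<gamma> :: 'g
  defines "u \<equiv> ratval a \<gamma>"
  assumes \<gamma>: "dominated \<gamma>" and X: "dominated (- u (to_fract [:0, 1:]))"
    and r: "r \<in> ratfuns L - {0}"
  shows "\<exists>s\<in>ratfuns K. krull_valuation.gt u (u r) (r - s)"
proof -
  interpret U: krull_valuation u unfolding u_def by (rule krull_valuation_ratval)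
  obtain p q where pq: "r = to_fract p / to_fract q" "p \<in> polys_over L" "q \<in> polys_over L" "q \<noteq> 0" "p \<noteq> 0"
    using r unfolding ratfuns_def by fastforce
  let ?p = "to_fract p" and ?q = "to_fract q"
  obtain p' where p': "p' \<in> polys_over K" "U.gt (u ?p) (?p - to_fract p')"
    using approx_poly[OF \<gamma>, of a p] X pq unfolding u_def by blast
  obtain q' where q': "q' \<in> polys_over K" "U.gt (u ?q) (?q - to_fract q')"
    using approx_poly[OF \<gamma>, of a q] X pq unfolding u_def by blast
  let ?p' = "to_fract p'" and ?q' = "to_fract q'"
  have nz: "?p \<noteq> 0" "?q \<noteq> 0" using pq by simp_all
  note p'' = U.eq_of_gt_diff[OF nz(1) p'(2)]
  note q'' = U.eq_of_gt_diff[OF nz(2) q'(2)]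
  have "U.gt (u ?p + u ?q) ((?p - ?p') * ?q' - (?q - ?q') * ?p')"
    using U.gt_mult_nonzero[OF p'(2) q''(1)] U.gt_mult_nonzero[OF q'(2) p''(1)] p'' q''
    by (intro U.gt_diff) (simp_all add: add.commute)
  then have "U.gt (u ?p + u ?q + u (inverse (?q * ?q'))) (((?p - ?p') * ?q' - (?q - ?q') * ?p') * inverse (?q * ?q'))"
    using nz q'' by (intro U.gt_mult_nonzero) simp_all
  moreover have "u ?p + u ?q + u (inverse (?q * ?q')) = u r"
    unfolding pq(1) using nz q'' by (simp add: U.divide U.inverse U.mult del: inverse_mult_distrib)
  moreover have "((?p - ?p') * ?q' - (?q - ?q') * ?p') * inverse (?q * ?q') = r - ?p' / ?q'"
    unfolding pq(1) using nz q'' by (simp add: field_simps)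
  ultimately have "U.gt (u r) (r - ?p' / ?q')" by metis
  moreover have "?p' / ?q' \<in> ratfuns K"
    unfolding ratfuns_def using p' q' q'' by auto
  ultimately show ?thesis by blast
qed

end

section \<open>Immediate extensions\<close>

text \<open>The negative is defined by reference to the carrier, so it has to be recomputed when the
  carrier shrinks.\<close>

lemma (in type_subfield) a_minus_carrier_update:
  assumes "x \<in> F" "y \<in> F"
  shows "x \<ominus>\<^bsub>ring_of_type_algebra\<lparr>carrier := F\<rparr>\<^esub> y = x - y"
proof -
  interpret R: field "ring_of_type_algebra :: 'a ring" by (rule field_from_type_algebra)
  interpret F: field "ring_of_type_algebra\<lparr>carrier := F\<rparr>" by (rule R.subfield_iff(2)[OF subfield])
  have "\<ominus>\<^bsub>ring_of_type_algebra\<lparr>carrier := F\<rparr>\<^esub> y = - y"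
    using F.minus_equality[of "- y" y] assms by (simp add: minus_closed)
  then show ?thesis by (simp add: a_minus_def)
qed

lemma (in krull_valuation) valued_field_carrier_update:
  assumes "subfield F ring_of_type_algebra"
  shows "valued_field (ring_of_type_algebra\<lparr>carrier := F\<rparr>) w"
proof -
  interpret R: field "ring_of_type_algebra :: 'a ring" by (rule field_from_type_algebra)
  show ?thesis
    using R.subfield_iff(2)[OF assms] add by (simp add: valued_field_def mult)
qed

lemma krull_valuation_of_valued_field:
  "valued_field (ring_of_type_algebra :: 'a::field ring) w \<Longrightarrow> krull_valuation w"
  by (simp add: valued_field_def krull_valuation_def)

lemma subfield_carrier_update:
  fixes A B :: "'a::field set"
  assumes "subfield A ring_of_type_algebra" "A \<subseteq> B" "subfield B ring_of_type_algebra"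
  shows "subfield A (ring_of_type_algebra\<lparr>carrier := B\<rparr>)"
proof -
  interpret R: field "ring_of_type_algebra :: 'a ring" by (rule field_from_type_algebra)
  interpret B: field "ring_of_type_algebra\<lparr>carrier := B\<rparr>" by (rule R.subfield_iff(2)[OF assms(3)])
  show ?thesis
    using B.subfield_iff(1)[of A] R.subfield_iff(2)[OF assms(1)] assms(2) by simp
qed

text \<open>An approximant in \<open>A\<close> with error beyond \<open>w x\<close> has the value of
  \<open>x\<close>; if \<open>w x\<close> is nonnegative, the error lies in the valuation ideal and
  the residues coincide too.\<close>

lemma (in krull_valuation) immediate_carrier_update:
  assumes A: "subfield A ring_of_type_algebra" and B: "subfield B ring_of_type_algebra" and "A \<subseteq> B"
    and v: "\<And>x. x \<in> A - {0} \<Longrightarrow> w x = v x"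
    and approx: "\<And>x. x \<in> B - {0} \<Longrightarrow> \<exists>y\<in>A. gt (w x) (x - y)"
  shows "immediate (ring_of_type_algebra\<lparr>carrier := B\<rparr>) w A v"
proof -
  let ?L = "ring_of_type_algebra\<lparr>carrier := B\<rparr>"
  interpret B: type_subfield B by (rule type_subfield.intro[OF B])
  interpret A: type_subfield A by (rule type_subfield.intro[OF A])
  have near: "\<exists>y\<in>A - {0}. w y = w x \<and> gt (w x) (x - y)" if "x \<in> B - {0}" for x
    using approx[OF that] eq_of_gt_diff[of x] that by blast
  let ?I = "valuation_ideal ?L w" and ?O = "valuation_ring ?L w"
  have coset: "?I +>\<^bsub>?O\<^esub> x = {h + x | h. h \<in> B \<and> gt 0 h}" for x
    by (auto simp: a_r_coset_def' valuation_ring_def valuation_ideal_def gt_def)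
  have coset_subset: "{h + x | h. h \<in> B \<and> gt 0 h} \<subseteq> {h + y | h. h \<in> B \<and> gt 0 h}"
    if "x \<in> B" "y \<in> B" "gt 0 (x - y)" for x y
  proof safe
    fix h assume "h \<in> B" "gt 0 h"
    with that have "h + (x - y) \<in> B" "gt 0 (h + (x - y))" "h + x = (h + (x - y)) + y"
      using B.add_closed[OF _ B.add_closed[OF _ B.minus_closed]] by (auto intro: gt_add)
    then show "\<exists>h'. h + x = h' + y \<and> h' \<in> B \<and> gt 0 h'" by blast
  qed
  have coset_eq: "?I +>\<^bsub>?O\<^esub> x = ?I +>\<^bsub>?O\<^esub> y" if "x \<in> B" "y \<in> B" "gt 0 (x - y)" for x y
  proof -
    have "gt 0 (y - x)" using that(3) gt_minus[of 0 "x - y"] unfolding minus_diff_eq by blast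
    with that show ?thesis unfolding coset by (intro subset_antisym coset_subset)
  qed
  have O: "carrier ?O = {x \<in> B. ge 0 x}"
    by (simp add: valuation_ring_def ge_def)
  have "\<exists>y \<in> A \<inter> carrier ?O. ?I +>\<^bsub>?O\<^esub> x = ?I +>\<^bsub>?O\<^esub> y" if x: "x \<in> carrier ?O" for x
  proof (cases "x = 0")
    case True
    then show ?thesis by (intro bexI[of _ 0]) (simp_all add: O)
  next
    case False
    with x obtain y where y: "y \<in> A - {0}" "w y = w x" "gt (w x) (x - y)"
      using near[of x] by (auto simp: O)
    with x False have "gt 0 (x - y)" "ge 0 y" by (auto simp: O ge_def gt_def)
    with y x coset_eq[of x y] \<open>A \<subseteq> B\<close> show ?thesis by (intro bexI[of _ y]) (auto simp: O)
  qed
  then have "carrier (residue_field ?L w) = residues ?L w A"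
    using \<open>A \<subseteq> B\<close>
    unfolding residue_field_def residues_def FactRing_def A_RCOSETS_def' O
    by auto blast
  moreover have "w ` (B - {0}) = w ` (A - {0})"
  proof (rule subset_antisym)
    show "w ` (B - {0}) \<subseteq> w ` (A - {0})"
      using near by (intro image_subsetI) (metis imageI)
    show "w ` (A - {0}) \<subseteq> w ` (B - {0})"
      using \<open>A \<subseteq> B\<close> by blast
  qed
  then have "value_group ?L w (carrier ?L) = value_group ?L w A"
    by (simp add: value_group_def)
  ultimately show ?thesis
    unfolding immediate_def valued_extension_def
    using valued_field_carrier_update[OF B] subfield_carrier_update[OF A \<open>A \<subseteq> B\<close> B] v by simp
qed

theorem corollary3p2:
  fixes K Khat :: "'a::alg_closed_field set"
    and v vhat :: "'a poly fract \<Rightarrow> 'g::linordered_ab_group_add"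
    and w :: "'a \<Rightarrow> 'g"
    and a :: 'a and \<gamma> :: 'g
  assumes "subfield K ring_of_type_algebra"
    and "valued_field (ratfun_field (algebraic_closure_in K)) v"
    and "valuation_transcendental (ratfun_field K) v (const_fract ` K)"
    and "\<forall>\<alpha> \<in> value_group (ratfun_field K) v (ratfuns K).
           \<exists>\<beta> \<in> value_group (ratfun_field K) v (const_fract ` K). \<alpha> \<le> \<beta>"
    and "subfield Khat ring_of_type_algebra"
    and "algebraic_closure_in Khat = UNIV"
    and "valued_extension ring_of_type_algebra w (algebraic_closure_in K) (v \<circ> const_fract)"
    and "is_completion (ring_of_type_algebra\<lparr>carrier := Khat\<rparr>) w K"
    and "minimal_pair_of_definition K v a \<gamma>"
    and "is_induced_valuation K v w vhat"
  shows "minimal_pair_of_definition Khat vhat a \<gamma> \<and>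
         simple_degree K a = simple_degree Khat a \<and>
         immediate (ratfun_field Khat) vhat (ratfuns K) v"
proof -
  let ?Kbar = "algebraic_closure_in K"
  let ?Lhat = "ring_of_type_algebra\<lparr>carrier := Khat\<rparr> :: 'a ring"
  interpret krull_valuation w
    using assms(7) by (simp add: valued_extension_def krull_valuation_of_valued_field)
  interpret K: type_subfield K by (rule type_subfield.intro[OF assms(1)])
  interpret Khat: type_subfield Khat by (rule type_subfield.intro[OF assms(5)])
  have Kbar: "subfield ?Kbar ring_of_type_algebra" and w: "\<And>x. x \<in> ?Kbar - {0} \<Longrightarrow> (v \<circ> const_fract) x = w x"
    using assms(7) by (simp_all add: valued_extension_def)
  interpret Kbar: type_subfield ?Kbar by (rule type_subfield.intro[OF Kbar])
  have "K \<subseteq> ?Kbar"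
  proof
    fix x assume "x \<in> K"
    then show "x \<in> ?Kbar"
      unfolding algebraic_closure_in_def mem_Collect_eq K.algebraic_iff
      by (intro bexI[of _ "[:-x, 1:]"]) (simp_all add: K.polys_over_pCons K.minus_closed)
  qed
  have completion: "subfield K ?Lhat" "dense_in ?Lhat w K"
    using assms(8) by (simp_all add: is_completion_def)
  have "K \<subseteq> Khat"
    using subfieldE(3)[OF completion(1)] by simp

  interpret dense_subfield w K Khat
  proof
    show "K \<subseteq> Khat" by fact
    fix x y assume xy: "x \<in> Khat" "y \<in> Khat - {0}"
    then have "w y \<in> value_group ?Lhat w (carrier ?Lhat)" by (simp add: value_group_def)
    with completion(2) xy obtain z where z: "z \<in> K"
        "x \<ominus>\<^bsub>?Lhat\<^esub> z = 0 \<or> w y < w (x \<ominus>\<^bsub>?Lhat\<^esub> z)"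
      unfolding dense_in_def by auto
    have "x \<ominus>\<^bsub>?Lhat\<^esub> z = x - z"
      using z(1) xy(1) \<open>K \<subseteq> Khat\<close> Khat.a_minus_carrier_update by blast
    with z show "\<exists>z\<in>K. gt (w y) (x - z)" unfolding gt_def by auto
  next
    fix x
    show "\<exists>p\<in>polys_over Khat. p \<noteq> 0 \<and> poly p x = 0"
      using assms(6) Khat.algebraic_iff[of x] unfolding algebraic_closure_in_def by auto
  qed

  \<comment> \<open>Over the algebraic closure of \<open>K\<close> the constants have the same
    values under \<open>v\<close> and \<open>w\<close>, so pairs of definition for \<open>v\<close>
    can be handled through \<open>ratval\<close>.\<close>
  have pair_val_Kbar: "pair_val ?Kbar (v \<circ> const_fract) b \<delta> r = ratval b \<delta> r"
    if "b \<in> ?Kbar" "r \<in> ratfuns ?Kbar - {0}" for b \<delta> r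
    using pair_val_eq_ratval[OF Kbar that(1) _ that(2)] w by blast
  have pairE: "b \<in> ?Kbar" "\<And>r. r \<in> ratfuns ?Kbar - {0} \<Longrightarrow> v r = ratval b \<delta> r"
    if "pair_of_definition K v b \<delta>" for b \<delta>
    using that pair_val_Kbar unfolding pair_of_definition_def by auto
  have linear: "ratval b \<delta> (to_fract [:- c, 1:]) = (if b = c then \<delta> else min (w (b - c)) \<delta>)" for b c \<delta>
    using pair_val_poly_linear[of b \<delta> c] by (simp add: ratval_to_fract)
  have linear_Kbar: "to_fract [:- c, 1:] \<in> ratfuns ?Kbar - {0}" if "c \<in> ?Kbar" for c
    using that by (simp add: Kbar.to_fract_ratfuns Kbar.polys_over_pCons Kbar.minus_closed)

  have minimal: "pair_of_definition K v a \<gamma>"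
      "\<And>b. b \<in> ?Kbar \<Longrightarrow> ge \<gamma> (a - b) \<Longrightarrow> simple_degree K a \<le> simple_degree K b"
  proof -
    show pair: "pair_of_definition K v a \<gamma>"
      using assms(9) by (simp add: minimal_pair_of_definition_def)
    fix b assume b: "b \<in> ?Kbar" "ge \<gamma> (a - b)"
    then have "a - b \<in> ?Kbar"
      using pairE(1)[OF pair] Kbar.add_closed[of a "- b"] Kbar.minus_closed by simp
    then have "a = b \<or> \<gamma> \<le> v (const_fract (a - b))"
      using b w[of "a - b"] by (cases "a = b") (simp_all add: ge_def)
    then show "simple_degree K a \<le> simple_degree K b"
      using assms(9) b(1) unfolding minimal_pair_of_definition_def by blast
  qed
  note a = pairE[OF minimal(1)]

  \<comment> \<open>The induced valuation may come from another pair. Evaluating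
    \<open>X - a\<close> and \<open>X - a'\<close> under both pairs gives \<gamma>' = \<gamma> and
    \<open>ge \<gamma> (a' - a)\<close>, hence the same valuation.\<close>
  obtain a' \<gamma>' where pair': "pair_of_definition K v a' \<gamma>'" and vhat: "vhat = ratval a' \<gamma>'"
    using assms(10) unfolding is_induced_valuation_def by blast
  note a' = pairE[OF pair']
  have eq: "ratval a \<gamma> r = ratval a' \<gamma>' r" if "r \<in> ratfuns ?Kbar - {0}" for r
    using a(2) a'(2) that by metis
  have \<gamma>_eq: "\<gamma> = (if a' = a then \<gamma>' else min (w (a' - a)) \<gamma>')"
    using eq[OF linear_Kbar[OF a(1)]] by (simp add: linear)
  have \<gamma>'_eq: "\<gamma>' = (if a = a' then \<gamma> else min (w (a - a')) \<gamma>)"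
    using eq[OF linear_Kbar[OF a'(1)]] by (simp add: linear)
  have "\<gamma>' = \<gamma>"
  proof (rule antisym)
    show "\<gamma>' \<le> \<gamma>" by (subst \<gamma>'_eq) simp
    show "\<gamma> \<le> \<gamma>'" by (subst \<gamma>_eq) simp
  qed
  moreover have "ge \<gamma> (a' - a)"
  proof (cases "a' = a")
    case False
    then show ?thesis unfolding ge_def by (subst \<gamma>_eq) simp
  qed simp
  ultimately have vhat_eq: "vhat r = ratval a \<gamma> r" if "r \<noteq> 0" for r
    using ratval_translate that vhat by blast

  \<comment> \<open>The cofinality hypothesis, carried over from \<open>v\<close> to
    \<open>w\<close>.\<close>
  have dominated_v: "dominated (v r)" if r: "r \<in> ratfuns K - {0}" for r
  proof -
    have "\<exists>s\<in>const_fract ` K - {0}. v r \<le> v s"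
      using r assms(4) by (simp add: value_group_def ratfun_field_def)
    then obtain c where "c \<in> K" "const_fract c \<noteq> 0" "v r \<le> v (const_fract c)"
      by blast
    then show ?thesis
      using w[of c] \<open>K \<subseteq> ?Kbar\<close> unfolding dominated_def const_fract_def by (intro bexI[of _ c]) auto
  qed
  have ratfuns_K: "ratfuns K \<subseteq> ratfuns ?Kbar" "ratfuns K \<subseteq> ratfuns Khat"
    using \<open>K \<subseteq> ?Kbar\<close> \<open>K \<subseteq> Khat\<close> by (simp_all add: ratfuns_mono)
  have v_K: "v r = ratval a \<gamma> r" if "r \<in> ratfuns K - {0}" for r
    using a(2) that ratfuns_K by blast
  have alg_a: "ring.algebraic ring_of_type_algebra K a"
    using a(1) by (simp add: algebraic_closure_in_def)
  \<comment> \<open>A polynomial over \<open>K\<close> with root \<open>a\<close> lies in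
    \<open>K(X)\<close>, so its value is dominated and bounds \<gamma>.\<close>
  have "dominated \<gamma>"
  proof -
    obtain f where f: "f \<in> polys_over K" "f \<noteq> 0" "poly f a = 0"
      using alg_a K.algebraic_iff by blast
    then have "dominated (pair_val_poly w a \<gamma> f)"
      using dominated_v[of "to_fract f"] v_K[of "to_fract f"] by (simp add: K.to_fract_ratfuns ratval_to_fract)
    with f show ?thesis using dominated_gamma by blast
  qed
  interpret U: krull_valuation "ratval a \<gamma>" by (rule krull_valuation_ratval)
  \<comment> \<open>The negated value of \<open>X\<close> is the value of \<open>1/X\<close>, again
    an element of \<open>K(X)\<close>.\<close>
  have dominated_X: "dominated (- ratval a \<gamma> (to_fract [:0, 1:]))"
  proof -
    let ?X = "to_fract [:0, 1:] :: 'a poly fract"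
    have "?X \<in> ratfuns K"
      by (simp add: K.to_fract_ratfuns K.polys_over_pCons)
    then have "inverse ?X \<in> ratfuns K - {0}"
      using type_subfield.inverse_closed[OF type_subfield.intro[OF K.subfield_ratfuns]] by simp
    then show ?thesis using dominated_v[of "inverse ?X"] v_K[of "inverse ?X"] U.inverse[of ?X] by simp
  qed

  \<comment> \<open>Serves twice: \<open>b = a\<close> gives one half of the equality of degrees,
    and general \<open>b\<close> then gives minimality over \<open>Khat\<close>.\<close>
  have degree_le: "simple_degree K a \<le> simple_degree Khat b" if b: "ge \<gamma> (a - b)" for b
  proof -
    have "ring.algebraic ring_of_type_algebra Khat b"
      using assms(6) unfolding algebraic_closure_in_def by auto
    then obtain h where h: "h \<in> polys_over Khat" "Polynomial.degree h = simple_degree Khat b"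
        "poly.coeff h (Polynomial.degree h) = 1" "poly h b = 0"
      by (rule Khat.monic_poly_of_simple_degree)
    obtain g c where g: "g \<in> polys_over K" "g \<noteq> 0" "Polynomial.degree g \<le> Polynomial.degree h"
        "poly g c = 0" "ge \<gamma> (b - c)"
      by (rule near_algebraic[OF \<open>dominated \<gamma>\<close> h(1,3,4)])
    have "c \<in> ?Kbar"
      using g K.algebraic_iff unfolding algebraic_closure_in_def by blast
    moreover have "ge \<gamma> (a - c)"
      using ge_add[OF b g(5)] by simp
    ultimately have "simple_degree K a \<le> simple_degree K c"
      by (rule minimal(2))
    also have "\<dots> \<le> Polynomial.degree g"
      by (rule K.simple_degree_le[OF g(1,2,4)])
    finally show ?thesis using g(3) h(2) by simp
  qed
  \<comment> \<open>The minimal polynomial of \<open>a\<close> over \<open>K\<close> also has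
    coefficients in \<open>Khat\<close>.\<close>
  have "simple_degree Khat a \<le> simple_degree K a"
  proof -
    obtain h where h: "h \<in> polys_over K" "Polynomial.degree h = simple_degree K a"
        "poly.coeff h (Polynomial.degree h) = 1" "poly h a = 0"
      using K.monic_poly_of_simple_degree[OF alg_a] .
    then have "h \<in> polys_over Khat" "h \<noteq> 0"
      using \<open>K \<subseteq> Khat\<close> by (auto simp: polys_over_def)
    with h show ?thesis using Khat.simple_degree_le by metis
  qed
  with degree_le[of a] have degree_eq: "simple_degree K a = simple_degree Khat a" by simp

  have vhat_const: "(vhat \<circ> const_fract) x = w x" if "x \<in> UNIV - {0}" for x
    using that by (simp add: vhat ratval_const)
  have "pair_of_definition Khat vhat a \<gamma>"
    unfolding pair_of_definition_def assms(6)
  proof (intro conjI ballI)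
    \<comment> \<open>The value \<gamma> is taken by \<open>X - a\<close>.\<close>
    show "\<gamma> \<in> vhat ` (ratfuns UNIV - {0})"
      using linear[of a \<gamma> a] vhat_eq[of "to_fract [:- a, 1:]"]
      by (intro image_eqI[of _ _ "to_fract [:- a, 1:]"]) simp_all
    show "vhat r = pair_val UNIV (vhat \<circ> const_fract) a \<gamma> r" if "r \<in> ratfuns UNIV - {0}" for r
      using pair_val_eq_ratval[OF subfield_UNIV, of a "vhat \<circ> const_fract" r \<gamma>] vhat_const vhat_eq that
      by simp
  qed simp
  moreover have "simple_degree Khat a \<le> simple_degree Khat b"
    if "a = b \<or> \<gamma> \<le> vhat (const_fract (a - b))" for b
    using degree_le[of b] that vhat_const[of "a - b"] degree_eq
    by (cases "a = b") (simp_all add: ge_def)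
  ultimately have "minimal_pair_of_definition Khat vhat a \<gamma>"
    unfolding minimal_pair_of_definition_def by blast
  moreover have "immediate (ratfun_field Khat) vhat (ratfuns K) v"
  proof -
    interpret V: krull_valuation vhat unfolding vhat by (rule krull_valuation_ratval)
    \<comment> \<open>\<open>vhat_eq\<close> speaks only of nonzero functions, but \<open>gt\<close>
      never consults the value at \<open>0\<close>, so the approximation for
      \<open>ratval a \<gamma>\<close> carries over to \<open>vhat\<close>.\<close>
    have "V.gt = U.gt"
    proof (intro ext)
      show "V.gt \<delta> r = U.gt \<delta> r" for \<delta> r
        using vhat_eq[of r] by (cases "r = 0") (simp_all add: U.gt_def V.gt_def)
    qed
    then show ?thesis
      unfolding ratfun_field_def
      using approx_ratfun[OF \<open>dominated \<gamma>\<close> dominated_X] vhat_eq v_K ratfuns_K(2)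
      by (intro V.immediate_carrier_update K.subfield_ratfuns Khat.subfield_ratfuns) auto
  qed
  ultimately show ?thesis using degree_eq by blast
qed

end
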